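(* Let $n\ge 2$ be an integer, let $1<p\le\infty$, and let $q$ be the exponent conjugate to $p$, i.e. $\frac1p+\frac1q=1$. For all $u\in h^p(B^n)$ and all $x\in B^n$ the inequality $$|u(x)|\le \frac{C_p(x)}{(1-|x|^2)^{(n-1)/p}}\,\|u\|_{h^p(B^n)}$$ holds, where $$C_p(x)=\left(F\left(-1+n-\frac{nq}{2},\ \frac12(n-nq),\ \frac n2,\ |x|^2\right)\right)^{1/q},$$ and the inequality is sharp: for each $x\in B^n$ the number $C_p(x)$ cannot be replaced by any smaller number so that the inequality remains valid for all $u\in h^p(B^n)$.
   Context: $B^n=\{x\in\mathbf R^n:|x|<1\}$ is the open unit ball of Euclidean space $\mathbf R^n$, $S=S^{n-1}$ is the unit sphere, and $\sigma$ is the unique rotation invariant Borel measure on $S$ normalized by $\sigma(S)=1$. For $1\le p<\infty$, the harmonic Hardy space $h^p(B^n)$ is the space of all harmonic functions $u$ on $B^n$ with $$\|u\|_{h^p(B^n)}^p=\sup_{0<r<1}\int_S|u(r\zeta)|^p\,d\sigma(\zeta)<\infty,$$ and $h^\infty(B^n)$ is the space of bounded harmonic functions on $B^n$ with $\|u\|_{h^\infty(B^n)}=\sup_{x\in B^n}|u(x)|$. When $p=\infty$ one has $q=1$ and $(n-1)/p=0$. $F$ is the Gauss hypergeometric function $$F(a,b,c,z)=1+\sum_{k=1}^\infty\frac{(a)_k(b)_k}{(c)_k\,k!}z^k,\qquad (d)_k=d(d+1)\cdots(d+k-1).$$ *)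

theory Defs
  imports "HOL-Analysis.Analysis"
begin

section \<open>The normalized rotation invariant measure on the unit sphere\<close>

definition rotation_invariant_sphere_measure :: "(real^'n) measure \<Rightarrow> bool" where
  "rotation_invariant_sphere_measure M \<longleftrightarrow>
     sets M = sets (restrict_space borel (sphere 0 1)) \<and>
     emeasure M (sphere 0 1) = 1 \<and>
     (\<forall>T A. orthogonal_transformation T \<longrightarrow> A \<in> sets M \<longrightarrow> emeasure M (T ` A) = emeasure M A)"

text \<open>The description determines the measure uniquely: see \<open>ex1_sphere_measure\<close> below.\<close>

definition sphere_measure :: "(real^'n) measure" where
  "sphere_measure = (THE M. rotation_invariant_sphere_measure M)"

lemma rotation_invariant_sphere_measure_facts:
  fixes M :: "(real^'n) measure"
  assumes "rotation_invariant_sphere_measure M"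
  shows "space M = sphere 0 1" "finite_measure M" "(\<lambda>x. x) \<in> measurable M borel"
    "\<And>A. A \<in> sets borel \<Longrightarrow> sphere 0 1 \<inter> A \<in> sets M"
proof -
  have s: "sets M = sets (restrict_space borel (sphere 0 1))" and e: "emeasure M (sphere 0 1) = 1"
    using assms by (auto simp: rotation_invariant_sphere_measure_def)
  show sp: "space M = sphere 0 1"
    using sets_eq_imp_space_eq[OF s] by (simp add: space_restrict_space)
  show "finite_measure M"
    by (rule finite_measureI) (simp add: sp e)
  show "(\<lambda>x. x) \<in> measurable M borel"
    unfolding measurable_cong_sets[OF s refl] by (rule measurable_restrict_space1) simp
  show "sphere 0 1 \<inter> A \<in> sets M" if "A \<in> sets borel" for A
    using that by (auto simp: s sets_restrict_space)
qed

lemma emeasure_cap_eq: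
  fixes M :: "(real^'n) measure"
  assumes M: "rotation_invariant_sphere_measure M"
    and "x \<in> sphere 0 1" "y \<in> sphere 0 1"
  shows "emeasure M (sphere 0 1 \<inter> ball x r) = emeasure M (sphere 0 1 \<inter> ball y r)"
proof -
  obtain T where T: "orthogonal_transformation T" "T x = y"
    using assms(2,3) orthogonal_transformation_exists[of x y] by auto
  have "T ` (sphere 0 1 \<inter> ball x r) = T ` sphere 0 1 \<inter> T ` ball x r"
    by (rule image_Int[OF orthogonal_transformation_inj[OF T(1)]])
  also have "\<dots> = sphere 0 1 \<inter> ball y r"
  proof -
    have "T ` sphere 0 1 = sphere 0 1"
      using orthogonal_transformation_surj[OF T(1)] orthogonal_transformation_norm[OF T(1)]
      by (force simp: surj_def)
    then show ?thesis
      using T image_orthogonal_transformation_ball[OF T(1), of x r] by simp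
  qed
  finally show ?thesis
    using M T(1) rotation_invariant_sphere_measure_facts(4)[OF M, of "ball x r"]
    unfolding rotation_invariant_sphere_measure_def by (metis borel_open open_ball)
qed

lemma emeasure_cap_pos:
  fixes M :: "(real^'n) measure"
  assumes M: "rotation_invariant_sphere_measure M"
    and x: "x \<in> sphere 0 1" and r: "r > 0"
  shows "emeasure M (sphere 0 1 \<inter> ball x r) \<noteq> 0"
proof
  assume 0: "emeasure M (sphere 0 1 \<inter> ball x r) = 0"
  have "compact (sphere (0::real^'n) 1)" by simp
  then obtain C where C: "C \<subseteq> sphere (0::real^'n) 1" "finite C" "sphere 0 1 \<subseteq> (\<Union>c\<in>C. ball c r)"
    using compactE_image[of "sphere (0::real^'n) 1" "sphere 0 1" "\<lambda>c. ball c r"] r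
    by (metis (no_types, lifting) UN_iff centre_in_ball open_ball subsetI)
  have "emeasure M (sphere 0 1) \<le> emeasure M (\<Union>c\<in>C. sphere 0 1 \<inter> ball c r)"
    by (rule emeasure_mono)
       (use C in \<open>auto intro!: sets.finite_UN rotation_invariant_sphere_measure_facts(4)[OF M]\<close>)
  also have "\<dots> \<le> (\<Sum>c\<in>C. emeasure M (sphere 0 1 \<inter> ball c r))"
    by (rule emeasure_subadditive_finite)
       (use C in \<open>auto intro!: rotation_invariant_sphere_measure_facts(4)[OF M]\<close>)
  also have "\<dots> = 0"
    using C(1) emeasure_cap_eq[OF M x] 0 by (intro sum.neutral) auto
  finally show False
    using M by (simp add: rotation_invariant_sphere_measure_def)
qed

lemma sphere_measure_Fubini:
  fixes M N :: "(real^'n) measure"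
  assumes M: "rotation_invariant_sphere_measure M" and N: "rotation_invariant_sphere_measure N"
    and x0: "x0 \<in> sphere 0 1" and F: "F \<in> sets borel"
  shows "emeasure N (sphere 0 1 \<inter> F) * emeasure M (sphere 0 1 \<inter> ball x0 r) =
    (\<integral>\<^sup>+x. emeasure N (sphere 0 1 \<inter> (F \<inter> ball x r)) \<partial>M)"
proof -
  note fM = rotation_invariant_sphere_measure_facts[OF M]
  note fN = rotation_invariant_sphere_measure_facts[OF N]
  interpret M: finite_measure M by (fact fM)
  interpret N: finite_measure N by (fact fN)
  interpret P: pair_sigma_finite M N ..
  let ?k = "\<lambda>x y. indicator F y * indicator (ball x r) y :: ennreal"
  have [measurable]: "(\<lambda>p. fst p) \<in> measurable (M \<Otimes>\<^sub>M N) borel" "(\<lambda>p. snd p) \<in> measurable (M \<Otimes>\<^sub>M N) borel"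
    using measurable_compose[OF measurable_fst fM(3)] measurable_compose[OF measurable_snd fN(3)]
    by auto
  have [measurable]: "F \<in> sets borel" by fact
  have k: "case_prod ?k = (\<lambda>p. indicator F (snd p) * (if dist (fst p) (snd p) < r then 1 else 0))"
    by (auto simp: indicator_def fun_eq_iff)
  have meas: "case_prod ?k \<in> borel_measurable (M \<Otimes>\<^sub>M N)"
    unfolding k by measurable
  have 1: "(\<integral>\<^sup>+y. ?k x y \<partial>N) = emeasure N (sphere 0 1 \<inter> (F \<inter> ball x r))" for x
  proof -
    have "(\<integral>\<^sup>+y. ?k x y \<partial>N) = (\<integral>\<^sup>+y. indicator (sphere 0 1 \<inter> (F \<inter> ball x r)) y \<partial>N)"
      by (rule nn_integral_cong) (auto simp: indicator_def fN(1))
    also have "\<dots> = emeasure N (sphere 0 1 \<inter> (F \<inter> ball x r))"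
      by (rule nn_integral_indicator) (auto intro!: fN(4))
    finally show ?thesis .
  qed
  have 2: "(\<integral>\<^sup>+x. ?k x y \<partial>M) = indicator F y * emeasure M (sphere 0 1 \<inter> ball x0 r)"
    if "y \<in> space N" for y
  proof -
    have "(\<integral>\<^sup>+x. ?k x y \<partial>M) = (\<integral>\<^sup>+x. indicator F y * indicator (sphere 0 1 \<inter> ball y r) x \<partial>M)"
      by (rule nn_integral_cong) (auto simp: indicator_def fM(1) dist_commute)
    also have "\<dots> = indicator F y * emeasure M (sphere 0 1 \<inter> ball y r)"
      by (rule nn_integral_cmult_indicator) (auto intro!: fM(4))
    finally show ?thesis
      using that emeasure_cap_eq[OF M x0] fN(1) by auto
  qed
  have "(\<integral>\<^sup>+x. emeasure N (sphere 0 1 \<inter> (F \<inter> ball x r)) \<partial>M) = (\<integral>\<^sup>+x. \<integral>\<^sup>+y. ?k x y \<partial>N \<partial>M)"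
    by (simp add: 1)
  also have "\<dots> = (\<integral>\<^sup>+y. \<integral>\<^sup>+x. ?k x y \<partial>M \<partial>N)"
    by (rule P.Fubini'[OF meas, symmetric])
  also have "\<dots> = (\<integral>\<^sup>+y. emeasure M (sphere 0 1 \<inter> ball x0 r) * indicator (sphere 0 1 \<inter> F) y \<partial>N)"
    using 2 by (intro nn_integral_cong) (auto simp: indicator_def fN(1))
  also have "\<dots> = emeasure M (sphere 0 1 \<inter> ball x0 r) * emeasure N (sphere 0 1 \<inter> F)"
    by (rule nn_integral_cmult_indicator) (auto intro!: fN(4) F)
  finally show ?thesis by (simp add: mult.commute)
qed

lemma sphere_measure_unique_le:
  fixes M N :: "(real^'n) measure"
  assumes M: "rotation_invariant_sphere_measure M" and N: "rotation_invariant_sphere_measure N"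
    and F: "closed F"
  shows "emeasure N (sphere 0 1 \<inter> F) \<le> emeasure M (sphere 0 1 \<inter> F)"
proof -
  note fM = rotation_invariant_sphere_measure_facts[OF M]
  note fN = rotation_invariant_sphere_measure_facts[OF N]
  interpret M: finite_measure M by (fact fM)
  interpret N: finite_measure N by (fact fN)
  obtain x0 :: "real^'n" where x0: "x0 \<in> sphere 0 1"
    using vector_choose_size[of 1] by (metis mem_sphere_0 zero_le_one)
  have capeq: "emeasure N (sphere 0 1 \<inter> ball x0 r) = emeasure M (sphere 0 1 \<inter> ball x0 r)" for r
  proof -
    have "emeasure M (sphere 0 1 \<inter> ball x0 r) = (\<integral>\<^sup>+x. emeasure N (sphere 0 1 \<inter> ball x r) \<partial>M)"
      using sphere_measure_Fubini[OF M N x0, of UNIV r] N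
      by (simp add: rotation_invariant_sphere_measure_def)
    also have "\<dots> = (\<integral>\<^sup>+x. emeasure N (sphere 0 1 \<inter> ball x0 r) \<partial>M)"
      using emeasure_cap_eq[OF N x0] by (intro nn_integral_cong) (auto simp: fM(1))
    also have "\<dots> = emeasure N (sphere 0 1 \<inter> ball x0 r)"
      using M by (simp add: fM(1) rotation_invariant_sphere_measure_def)
    finally show ?thesis by simp
  qed
  define G where "G r = (\<Union>y\<in>F. ball y r)" for r
  have nbhd: "emeasure N (sphere 0 1 \<inter> F) \<le> emeasure M (sphere 0 1 \<inter> G r)" if r: "r > 0" for r
  proof -
    let ?h = "emeasure M (sphere 0 1 \<inter> ball x0 r)"
    have "emeasure N (sphere 0 1 \<inter> F) * ?h
        = (\<integral>\<^sup>+x. emeasure N (sphere 0 1 \<inter> (F \<inter> ball x r)) \<partial>M)"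
      by (rule sphere_measure_Fubini[OF M N x0]) (use F in auto)
    also have "\<dots> \<le> (\<integral>\<^sup>+x. ?h * indicator (sphere 0 1 \<inter> G r) x \<partial>M)"
    proof (rule nn_integral_mono)
      fix x assume x: "x \<in> space M"
      show "emeasure N (sphere 0 1 \<inter> (F \<inter> ball x r)) \<le> ?h * indicator (sphere 0 1 \<inter> G r) x"
      proof (cases "x \<in> G r")
        case True
        have "emeasure N (sphere 0 1 \<inter> (F \<inter> ball x r)) \<le> emeasure N (sphere 0 1 \<inter> ball x r)"
          by (rule emeasure_mono) (auto intro!: fN(4))
        also have "\<dots> = ?h"
          using emeasure_cap_eq[OF N x0, of x r] capeq x fM(1) by auto
        finally show ?thesis using True x fM(1) by auto
      next
        case False
        then have "F \<inter> ball x r = {}" by (auto simp: G_def dist_commute)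
        then show ?thesis by simp
      qed
    qed
    also have "\<dots> = ?h * emeasure M (sphere 0 1 \<inter> G r)"
      by (rule nn_integral_cmult_indicator) (auto intro!: fM(4) borel_open simp: G_def)
    finally have "?h * emeasure N (sphere 0 1 \<inter> F) \<le> ?h * emeasure M (sphere 0 1 \<inter> G r)"
      by (simp add: mult.commute)
    moreover have "?h \<noteq> 0" by (rule emeasure_cap_pos[OF M x0 r])
    moreover have "?h \<noteq> top" by simp
    ultimately show ?thesis
      by (simp add: ennreal_mult_le_mult_iff)
  qed
  let ?A = "\<lambda>k::nat. sphere 0 1 \<inter> G (inverse (real (Suc k)))"
  have F_eq: "F = (\<Inter>k. G (inverse (real (Suc k))))"
  proof
    show "F \<subseteq> (\<Inter>k. G (inverse (real (Suc k))))"
      unfolding G_def by (force simp: centre_in_ball)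
    show "(\<Inter>k. G (inverse (real (Suc k)))) \<subseteq> F"
    proof
      fix x assume x: "x \<in> (\<Inter>k. G (inverse (real (Suc k))))"
      have "\<exists>y\<in>F. dist y x < e" if "e > 0" for e
      proof -
        obtain k where "inverse (real (Suc k)) < e" using reals_Archimedean \<open>e > 0\<close> by blast
        moreover have "x \<in> G (inverse (real (Suc k)))" using x by blast
        ultimately show ?thesis unfolding G_def by (auto intro: less_trans)
      qed
      then have "x \<in> closure F" by (auto simp: closure_approachable)
      then show "x \<in> F" using F by simp
    qed
  qed
  have dec: "decseq ?A"
  proof (rule decseq_SucI)
    fix k :: nat
    have "inverse (real (Suc (Suc k))) \<le> inverse (real (Suc k))" by (simp add: field_simps)
    then show "?A (Suc k) \<subseteq> ?A k"
      unfolding G_def by (intro Int_mono UN_mono subset_ball order_refl)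
  qed
  have "(\<lambda>k. emeasure M (?A k)) \<longlonglongrightarrow> emeasure M (\<Inter>k. ?A k)"
    by (rule Lim_emeasure_decseq[OF _ dec]) (auto intro!: fM(4) borel_open simp: G_def)
  moreover have "(\<Inter>k. ?A k) = sphere 0 1 \<inter> F" by (subst F_eq) auto
  ultimately have "(\<lambda>k. emeasure M (?A k)) \<longlonglongrightarrow> emeasure M (sphere 0 1 \<inter> F)" by simp
  then show ?thesis
    by (rule LIMSEQ_le_const) (use nbhd in auto)
qed

lemma sphere_measure_unique:
  fixes M N :: "(real^'n) measure"
  assumes M: "rotation_invariant_sphere_measure M" and N: "rotation_invariant_sphere_measure N"
  shows "M = N"
proof -
  note fM = rotation_invariant_sphere_measure_facts[OF M]
  note fN = rotation_invariant_sphere_measure_facts[OF N]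
  have s: "sets M = sets (restrict_space borel (sphere 0 1))" "sets N = sets (restrict_space borel (sphere 0 1))"
    using M N by (auto simp: rotation_invariant_sphere_measure_def)
  interpret M: finite_measure M by (fact fM)
  have em: "emeasure (distr M borel (\<lambda>x. x)) A = emeasure M (sphere 0 1 \<inter> A)" if "A \<in> sets borel" for A
    using that fM by (simp add: emeasure_distr Int_commute vimage_def Collect_conj_eq)
  have en: "emeasure (distr N borel (\<lambda>x. x)) A = emeasure N (sphere 0 1 \<inter> A)" if "A \<in> sets borel" for A
    using that fN by (simp add: emeasure_distr Int_commute vimage_def Collect_conj_eq)
  have "distr M borel (\<lambda>x. x) = distr N borel (\<lambda>x. x)"
  proof (rule measure_eqI_generator_eq[where E = "Collect closed" and \<Omega> = UNIV and A = "\<lambda>_. UNIV"])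
    show "Int_stable (Collect (closed :: (real^'n) set \<Rightarrow> bool))"
      by (auto simp: Int_stable_def)
    show "emeasure (distr M borel (\<lambda>x. x)) X = emeasure (distr N borel (\<lambda>x. x)) X"
      if "X \<in> Collect closed" for X
      using that sphere_measure_unique_le[OF M N, of X] sphere_measure_unique_le[OF N M, of X]
      by (simp add: em en)
    show "sets (distr M borel (\<lambda>x. x)) = sigma_sets UNIV (Collect closed)"
      "sets (distr N borel (\<lambda>x. x)) = sigma_sets UNIV (Collect closed)"
      by (simp_all add: borel_eq_closed)
    show "emeasure (distr M borel (\<lambda>x. x)) UNIV \<noteq> \<infinity>"
      by (simp add: em)
  qed auto
  note eq = this
  show ?thesis
  proof (rule measure_eqI)
    show "sets M = sets N" by (simp add: s)
    fix A assume "A \<in> sets M"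
    then obtain B where B: "B \<in> sets borel" "A = sphere 0 1 \<inter> B"
      by (auto simp: s sets_restrict_space)
    then show "emeasure M A = emeasure N A"
      using em[OF B(1)] en[OF B(1)] eq by simp
  qed
qed

text \<open>Lebesgue measure is rotation invariant. (The corresponding results of
  \<^theory>\<open>HOL-Analysis.Change_Of_Vars\<close> need a well-ordered index type.)\<close>

lemma emeasure_lborel_orthogonal_le:
  fixes T :: "'a::euclidean_space \<Rightarrow> 'a"
  assumes T: "orthogonal_transformation T" and U: "open U"
  shows "emeasure lborel U \<le> emeasure lborel (T ` U)"
proof -
  let ?K = "{(a, r). r > 0 \<and> ball a r \<subseteq> U}"
  have cover: "\<exists>i. i \<in> ?K \<and> x \<in> ball (fst i) (snd i) \<and> snd i < d" if x: "x \<in> U" and d: "0 < d" for x d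
  proof -
    obtain e where e: "e > 0" "ball x e \<subseteq> U"
      using U x open_contains_ball by blast
    have "ball x (min e (d / 2)) \<subseteq> U"
      using e by (meson min.cobounded1 order_trans subset_ball)
    then show ?thesis
      using e d by (intro exI[of _ "(x, min e (d / 2))"]) auto
  qed
  obtain C where C: "countable C" "C \<subseteq> ?K"
    "pairwise (\<lambda>i j. disjnt (ball (fst i) (snd i)) (ball (fst j) (snd j))) C"
    "negligible (U - (\<Union>i\<in>C. ball (fst i) (snd i)))"
    using Vitali_covering_theorem_balls[of U ?K fst snd, OF cover] by blast
  let ?X = "\<lambda>i. ball (fst i) (snd i)" and ?Y = "\<lambda>i. ball (T (fst i)) (snd i)"
  have YX: "?Y i = T ` ?X i" for i
    by (simp add: image_orthogonal_transformation_ball[OF T])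
  have disjX: "disjoint_family_on ?X C"
    using C(3) by (auto simp: disjoint_family_on_def pairwise_def disjnt_def)
  have disjY: "disjoint_family_on ?Y C"
    unfolding disjoint_family_on_def YX
  proof (intro ballI impI)
    fix i j assume "i \<in> C" "j \<in> C" "i \<noteq> j"
    then have "?X i \<inter> ?X j = {}" using disjX by (auto simp: disjoint_family_on_def)
    then show "T ` ?X i \<inter> T ` ?X j = {}"
      using orthogonal_transformation_inj[OF T] by (metis image_Int image_empty)
  qed
  have opX: "open (\<Union>i\<in>C. ?X i)" by auto
  have "U - (\<Union>i\<in>C. ?X i) \<in> null_sets lborel"
    using C(4) U opX null_sets_completion_iff[of "U - (\<Union>i\<in>C. ?X i)" lborel]
    by (auto simp: negligible_iff_null_sets)
  then have N: "emeasure lborel (U - (\<Union>i\<in>C. ?X i)) = 0" by auto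
  have "emeasure lborel U \<le> emeasure lborel ((\<Union>i\<in>C. ?X i) \<union> (U - (\<Union>i\<in>C. ?X i)))"
    by (rule emeasure_mono) (use U opX in auto)
  also have "\<dots> \<le> emeasure lborel (\<Union>i\<in>C. ?X i) + emeasure lborel (U - (\<Union>i\<in>C. ?X i))"
    by (rule emeasure_subadditive) (use U opX in auto)
  also have "\<dots> = (\<integral>\<^sup>+i. emeasure lborel (?X i) \<partial>count_space C)"
    unfolding N using C(1) disjX by (simp add: emeasure_UN_countable)
  also have "\<dots> = (\<integral>\<^sup>+i. emeasure lborel (?Y i) \<partial>count_space C)"
    using C(2) by (intro nn_integral_cong) (force simp: emeasure_ball)
  also have "\<dots> = emeasure lborel (\<Union>i\<in>C. ?Y i)"
    using C(1) disjY by (simp add: emeasure_UN_countable)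
  also have "\<dots> \<le> emeasure lborel (T ` U)"
  proof (rule emeasure_mono)
    show "(\<Union>i\<in>C. ?Y i) \<subseteq> T ` U" using C(2) unfolding YX by fastforce
    have "open (T ` U)"
      by (rule open_surjective_linear_image)
         (use U T orthogonal_transformation_surj orthogonal_transformation_linear in auto)
    then show "T ` U \<in> sets lborel" by simp
  qed
  finally show ?thesis .
qed

lemma lborel_distr_orthogonal:
  fixes T :: "'a::euclidean_space \<Rightarrow> 'a"
  assumes T: "orthogonal_transformation T"
  shows "distr lborel borel T = lborel"
proof (rule lborel_eqI[symmetric])
  have m: "T \<in> borel_measurable borel"
    using orthogonal_transformation_linear[OF T]
    by (intro borel_measurable_continuous_onI linear_continuous_on linear_linear[THEN iffD2])
  have surj: "surj T" and inj: "inj T"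
    using T by (auto simp: orthogonal_transformation_surj orthogonal_transformation_inj)
  fix l u :: 'a assume lu: "\<And>b. b \<in> Basis \<Longrightarrow> l \<bullet> b \<le> u \<bullet> b"
  have iT: "orthogonal_transformation (inv T)" by (rule orthogonal_transformation_inv[OF T])
  have im: "T -` box l u = inv T ` box l u"
    using surj inj by (simp add: bij_vimage_eq_inv_image bij_def)
  have op: "open (inv T ` box l u)"
    by (rule open_surjective_linear_image)
       (use iT orthogonal_transformation_surj orthogonal_transformation_linear in auto)
  have "T ` inv T ` box l u = box l u"
    using surj by (simp add: image_comp surj_iff)
  then have "emeasure lborel (inv T ` box l u) = emeasure lborel (box l u)"
    using emeasure_lborel_orthogonal_le[OF T op] emeasure_lborel_orthogonal_le[OF iT open_box, of l u]
    by auto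
  then show "emeasure (distr lborel borel T) (box l u) = (\<Prod>b\<in>Basis. (u - l) \<bullet> b)"
    using m lu by (simp add: emeasure_distr im emeasure_lborel_box)
qed simp

text \<open>Existence: the radial projection of normalized Lebesgue measure on the unit ball.\<close>

lemma ex_sphere_measure: "\<exists>M :: (real^'n) measure. rotation_invariant_sphere_measure M"
proof -
  let ?S = "sphere (0::real^'n) 1" and ?B = "ball (0::real^'n) 1"
  obtain x0 :: "real^'n" where x0: "x0 \<in> ?S"
    using vector_choose_size[of 1] by (metis mem_sphere_0 zero_le_one)
  define f where "f x = (if x = 0 then x0 else x /\<^sub>R norm x)" for x :: "real^'n"
  define M where "M = distr (uniform_measure lborel ?B) (restrict_space borel ?S) f"
  have f0: "f x \<in> ?S" for x
    using x0 by (simp add: f_def)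
  have "f \<in> borel_measurable borel"
    unfolding f_def by measurable
  then have f: "f \<in> measurable borel (restrict_space borel ?S)"
    by (rule measurable_restrict_space2[rotated]) (use f0 in auto)
  have Mset: "sets M = sets (restrict_space borel ?S)"
    by (simp add: M_def)
  have Mborel: "A \<in> sets borel" "A \<subseteq> ?S" if "A \<in> sets M" for A
    using that unfolding Mset by (auto simp: sets_restrict_space intro: borel_closed)
  have vim: "f -` A \<in> sets borel" if "A \<in> sets M" for A
    using measurable_sets[OF f] that by (simp add: Mset)
  have eM: "emeasure M A = emeasure lborel (?B \<inter> f -` A) / emeasure lborel ?B" if "A \<in> sets M" for A
    using that vim[OF that] f by (simp add: M_def emeasure_distr)
  have "measure lborel ?B > 0"
    by (rule content_ball_pos) simp
  then have B0: "emeasure lborel ?B \<noteq> 0"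
    by (auto simp: measure_def)
  have Btop: "emeasure lborel ?B \<noteq> \<infinity>"
    using emeasure_lborel_ball_finite[of "0::real^'n" 1] by auto
  have S: "?S \<in> sets M"
    by (auto simp: Mset sets_restrict_space)
  have "emeasure M ?S = 1"
    using f0 B0 Btop by (simp add: eM[OF S] vimage_def ennreal_divide_self top.not_eq_extremum[symmetric])
  moreover have "emeasure M (T ` A) = emeasure M A"
    if T: "orthogonal_transformation T" and A: "A \<in> sets M" for T A
  proof -
    have lin: "linear T" and norm_T: "\<And>x. norm (T x) = norm x" and inj: "inj T" and surj: "surj T"
      using T by (auto simp: orthogonal_transformation orthogonal_transformation_inj orthogonal_transformation_surj)
    have Tm: "T \<in> borel_measurable borel"
      using lin by (intro borel_measurable_continuous_onI linear_continuous_on linear_linear[THEN iffD2])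
    have "linear (inv T)"
      using T by (simp add: orthogonal_transformation_inv orthogonal_transformation_linear)
    then have "inv T \<in> borel_measurable borel"
      by (intro borel_measurable_continuous_onI linear_continuous_on linear_linear[THEN iffD2])
    then have "inv T -` A \<in> sets borel"
      using measurable_sets[of "inv T" borel borel A] Mborel[OF A] by simp
    moreover have "inv T -` A = T ` A"
      using inj surj by (force simp: surj_f_inv_f intro: image_eqI[of _ T "inv T _"])
    moreover have "T ` A \<subseteq> ?S"
      using Mborel[OF A] norm_T by auto
    ultimately have TA: "T ` A \<in> sets M"
      unfolding Mset sets_restrict_space by (auto intro!: image_eqI[of _ _ "T ` A"])
    define Q where "Q A = (?B \<inter> f -` A) - {0}" for A
    have Qsets: "Q A \<in> sets borel" if "A \<in> sets M" for A
      using vim[OF that] by (simp add: Q_def)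
    have Qem: "emeasure lborel (?B \<inter> f -` A) = emeasure lborel (Q A)" if "A \<in> sets M" for A
      unfolding Q_def by (rule emeasure_Diff_null_set[symmetric]) (use vim[OF that] in \<open>auto simp: null_sets_def\<close>)
    have fT: "f (T x) = T (f x)" if "x \<noteq> 0" for x
      using that norm_T[of x] by (auto simp: f_def linear_scale[OF lin])
    have QT: "Q (T ` A) = T ` Q A"
    proof
      show "T ` Q A \<subseteq> Q (T ` A)"
        using norm_T fT by (auto simp: Q_def) (metis norm_eq_zero)
      show "Q (T ` A) \<subseteq> T ` Q A"
      proof
        fix y assume y: "y \<in> Q (T ` A)"
        obtain x where x: "y = T x" using surj by (metis surjD)
        have x0: "x \<noteq> 0" and "norm x < 1" and "f (T x) \<in> T ` A"
          using x y norm_T linear_0[OF lin] unfolding Q_def by auto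
        moreover have "T (f x) \<in> T ` A"
          using calculation(3) fT[OF x0] by simp
        ultimately have "x \<noteq> 0" "norm x < 1" "T (f x) \<in> T ` A" by auto
        then have "x \<in> Q A" using inj by (auto simp: Q_def inj_image_mem_iff)
        then show "y \<in> T ` Q A" using x by blast
      qed
    qed
    have "emeasure lborel (T ` Q A) = emeasure lborel (Q A)"
    proof -
      have "emeasure lborel (T ` Q A) = emeasure (distr lborel borel T) (T ` Q A)"
        by (simp add: lborel_distr_orthogonal[OF T])
      also have "\<dots> = emeasure lborel (T -` T ` Q A)"
        using Tm Qsets[OF TA] QT by (simp add: emeasure_distr)
      finally show ?thesis by (simp add: inj_vimage_image_eq[OF inj])
    qed
    then show ?thesis
      using A TA by (simp add: eM Qem QT)
  qed
  ultimately show ?thesis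
    unfolding rotation_invariant_sphere_measure_def using Mset by blast
qed

theorem ex1_sphere_measure: "\<exists>!M :: (real^'n) measure. rotation_invariant_sphere_measure M"
  using ex_sphere_measure sphere_measure_unique by blast

lemma rotation_invariant_sphere_measure: "rotation_invariant_sphere_measure sphere_measure"
  unfolding sphere_measure_def by (rule theI'[OF ex1_sphere_measure])


section \<open>Harmonic functions and harmonic Hardy spaces\<close>

text \<open>A harmonic function is a real-valued \<open>C\<^sup>2\<close> function whose Laplacian, the trace of the second
  derivative \<open>D2\<close>, vanishes.\<close>

definition harmonic_on :: "('a::euclidean_space \<Rightarrow> real) \<Rightarrow> 'a set \<Rightarrow> bool" (infix "harmonic'_on" 50) where
  "u harmonic_on U \<longleftrightarrow>
     (\<exists>(D :: 'a \<Rightarrow> 'a \<Rightarrow>\<^sub>L real) (D2 :: 'a \<Rightarrow> 'a \<Rightarrow>\<^sub>L 'a \<Rightarrow>\<^sub>L real).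
        (\<forall>x\<in>U. (u has_derivative blinfun_apply (D x)) (at x)) \<and>
        (\<forall>x\<in>U. (D has_derivative blinfun_apply (D2 x)) (at x)) \<and>
        continuous_on U D2 \<and>
        (\<forall>x\<in>U. (\<Sum>b\<in>Basis. blinfun_apply (blinfun_apply (D2 x) b) b) = 0))"

text \<open>The \<open>p\<close>-th power of the \<open>h\<^sup>p\<close> norm, for \<open>p < \<infinity>\<close>.\<close>

definition hardy_mean :: "real \<Rightarrow> (real^'n \<Rightarrow> real) \<Rightarrow> ennreal" where
  "hardy_mean p u =
     (SUP r\<in>{0<..<1}. \<integral>\<^sup>+ \<zeta>. ennreal (\<bar>u (r *\<^sub>R \<zeta>)\<bar> powr p) \<partial>sphere_measure)"

definition hardy_space :: "ereal \<Rightarrow> (real^'n \<Rightarrow> real) set" where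
  "hardy_space p =
     {u. u harmonic_on ball 0 1 \<and>
         (if p = \<infinity> then bounded (u ` ball 0 1) else hardy_mean (real_of_ereal p) u < \<infinity>)}"

definition hardy_norm :: "ereal \<Rightarrow> (real^'n \<Rightarrow> real) \<Rightarrow> real" where
  "hardy_norm p u =
     (if p = \<infinity> then SUP x\<in>ball 0 1. \<bar>u x\<bar>
      else enn2real (hardy_mean (real_of_ereal p) u) powr (1 / real_of_ereal p))"


section \<open>The hypergeometric function and the constant\<close>

definition hypergeometric_F :: "real \<Rightarrow> real \<Rightarrow> real \<Rightarrow> real \<Rightarrow> real" where
  "hypergeometric_F a b c z =
     (\<Sum>k. pochhammer a k * pochhammer b k / (pochhammer c k * fact k) * z ^ k)"

definition hardy_const :: "real \<Rightarrow> real^'n \<Rightarrow> real" where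
  "hardy_const q x =
     (let n = real CARD('n) in
        hypergeometric_F (-1 + n - n * q / 2) (1 / 2 * (n - n * q)) (n / 2) ((norm x)\<^sup>2) powr (1 / q))"

end

theory Submission
  imports Defs
begin

text \<open>
  Write \<open>n\<close> for the dimension, \<open>\<sigma>\<close> for the normalized surface measure and
  \<open>P(x, \<zeta>) = (1 - \<bar>x\<bar>\<^sup>2) / \<bar>x - \<zeta>\<bar>\<^sup>n\<close> for the Poisson kernel of the ball. A function \<open>u\<close> in \<open>h\<^sup>p\<close> is, on
  every smaller ball, the Poisson integral of its own values: \<open>u(r x) = \<integral> P(x, \<zeta>) u(r \<zeta>) d\<sigma>(\<zeta>)\<close>
  (\<open>poisson_representation\<close>). Hoelder's inequality and \<open>r \<rightarrow> 1\<close> give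
  \<open>\<bar>u(x)\<bar> \<le> \<parallel>P(x, \<cdot>)\<parallel>\<^sub>q \<parallel>u\<parallel>\<close> (\<open>hardy_space_pointwise_bound\<close>). Equality holds for the Poisson integral of
  \<open>P(x, \<cdot>)\<^bsup>q-1\<^esup>\<close> (\<open>hardy_space_extremal\<close>), because Poisson integration does not increase the \<open>L\<^sup>p\<close> norm;
  this in turn follows from \<open>\<integral> P d\<sigma> = 1\<close>, used once in each of the two variables
  (\<open>hardy_mean_poisson_integral_le\<close>). So for finite \<open>p\<close> the sharp constant is \<open>\<parallel>P(x, \<cdot>)\<parallel>\<^sub>q\<close>, and what remains
  is to express \<open>\<integral> P(x, \<zeta>)\<^sup>q d\<sigma>(\<zeta>)\<close> by the hypergeometric function (\<open>integral_poisson_kernel_powr\<close>). For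
  \<open>p = \<infinity>\<close> the mean is that of \<open>P\<close> itself, the constant is 1, and constant functions are extremal.

  All of this rests on one family of functions, the potentials
  \<open>U(x) = \<integral> \<bar>x - \<zeta>\<bar>\<^bsup>-2s\<^esup> f(\<zeta>) d\<sigma>(\<zeta>)\<close>, and on one differential equation for them, proved in
  \<open>sphere_potential_equation\<close>:

  \<open>(1 - \<bar>x\<bar>\<^sup>2) \<Delta>U = 4 (s + 1 - n/2) (x \<bullet> \<nabla>U + s U)\<close>.

  For \<open>s = n/2\<close> it says that \<open>(1 - \<bar>x\<bar>\<^sup>2) U\<close>, which is the Poisson integral of \<open>f\<close>, is harmonic. For
  \<open>s = n q/2\<close> and \<open>f = 1\<close> the function \<open>U\<close> is radial, and \<open>(1 - \<bar>x\<bar>\<^sup>2)\<^sup>q U\<close> is the wanted mean of \<open>P\<^sup>q\<close>. By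
  Euler's transformation of the hypergeometric equation,
  \<open>G(x) = (1 - \<bar>x\<bar>\<^sup>2)\<^bsup>n-1-2s\<^esup> F(n-1-s, n/2-s, n/2, \<bar>x\<bar>\<^sup>2)\<close> is another radial solution of the same equation.

  To identify two radial solutions, choose \<open>c\<close> such that \<open>G - c U\<close> vanishes at one point. It then
  vanishes on the whole sphere through that point, by the maximum principle also inside the sphere,
  and the values at the origin show \<open>c = 1\<close>. This gives \<open>G = U\<close> (\<open>sphere_potential_hypergeometric\<close>).
  The same argument for Laplace's equation compares \<open>\<integral> P(x, \<zeta>) d\<sigma>(\<zeta>)\<close> with a constant and shows that
  it equals 1 (\<open>poisson_integral_one\<close>).
\<close>


section \<open>Integration over the sphere\<close>

lemma space_sphere_measure [simp]: "space (sphere_measure :: (real^'n) measure) = sphere 0 1"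
  by (rule rotation_invariant_sphere_measure_facts(1)[OF rotation_invariant_sphere_measure])

lemma sets_sphere_measure:
  "sets (sphere_measure :: (real^'n) measure) = sets (restrict_space borel (sphere 0 1))"
  using rotation_invariant_sphere_measure by (auto simp: rotation_invariant_sphere_measure_def)

interpretation sphere_measure: finite_measure "sphere_measure :: (real^'n) measure"
  by (rule rotation_invariant_sphere_measure_facts(2)[OF rotation_invariant_sphere_measure])

lemma measure_sphere_measure [simp]: "measure (sphere_measure :: (real^'n) measure) (sphere 0 1) = 1"
  using rotation_invariant_sphere_measure
  by (auto simp: rotation_invariant_sphere_measure_def measure_def)

lemma sphere_integral_const [simp]:
  fixes c :: "'b::{banach, second_countable_topology}"
  shows "(\<integral>(\<zeta>::real^'n). c \<partial>sphere_measure) = c"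
  by simp

lemma measurable_sphere_continuous:
  fixes f :: "real^'n \<Rightarrow> 'b::topological_space"
  assumes "continuous_on (sphere 0 1) f"
  shows "f \<in> borel_measurable sphere_measure"
  unfolding measurable_cong_sets[OF sets_sphere_measure refl]
  by (rule borel_measurable_continuous_on_restrict[OF assms])

lemma integrable_sphere_continuous:
  fixes f :: "real^'n \<Rightarrow> 'b::{banach, second_countable_topology}"
  assumes "continuous_on (sphere 0 1) f"
  shows "integrable sphere_measure f"
proof -
  have "bounded (f ` sphere 0 1)"
    by (intro compact_imp_bounded compact_continuous_image assms) simp
  then obtain B where "\<forall>x\<in>sphere 0 1. norm (f x) \<le> B"
    by (auto simp: bounded_iff)
  then show ?thesis
    by (intro sphere_measure.integrable_const_bound[where B = B] measurable_sphere_continuous assms AE_I2)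
       auto
qed

lemma sphere_integral_mono:
  fixes f g :: "real^'n \<Rightarrow> real"
  assumes "continuous_on (sphere 0 1) f" "continuous_on (sphere 0 1) g"
    and "\<And>\<zeta>. norm \<zeta> = 1 \<Longrightarrow> f \<zeta> \<le> g \<zeta>"
  shows "(\<integral>\<zeta>. f \<zeta> \<partial>sphere_measure) \<le> (\<integral>\<zeta>. g \<zeta> \<partial>sphere_measure)"
  using assms by (intro integral_mono integrable_sphere_continuous) auto

lemma sphere_integral_cong:
  fixes f g :: "real^'n \<Rightarrow> 'b::{banach, second_countable_topology}"
  assumes "\<And>\<zeta>. norm \<zeta> = 1 \<Longrightarrow> f \<zeta> = g \<zeta>"
  shows "(\<integral>\<zeta>. f \<zeta> \<partial>sphere_measure) = (\<integral>\<zeta>. g \<zeta> \<partial>sphere_measure)"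
  using assms by (intro Bochner_Integration.integral_cong) auto

lemma norm_sphere_integral_le:
  fixes f :: "real^'n \<Rightarrow> 'b::{banach, second_countable_topology}"
  assumes "continuous_on (sphere 0 1) f" and "\<And>\<zeta>. norm \<zeta> = 1 \<Longrightarrow> norm (f \<zeta>) \<le> B"
  shows "norm (\<integral>\<zeta>. f \<zeta> \<partial>sphere_measure) \<le> B"
proof -
  have "norm (\<integral>\<zeta>. f \<zeta> \<partial>sphere_measure) \<le> (\<integral>\<zeta>. norm (f \<zeta>) \<partial>sphere_measure)"
    by (rule integral_norm_bound)
  also have "\<dots> \<le> (\<integral>(\<zeta>::real^'n). B \<partial>sphere_measure)"
    by (rule sphere_integral_mono) (use assms in \<open>auto intro!: continuous_intros\<close>)
  finally show ?thesis by simp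
qed

lemma sphere_integral_rotation:
  fixes f :: "real^'n \<Rightarrow> 'b::{banach, second_countable_topology}"
    and T :: "real^'n \<Rightarrow> real^'n"
  assumes T: "orthogonal_transformation T" and f: "continuous_on (sphere 0 1) f"
  shows "(\<integral>\<zeta>. f (T \<zeta>) \<partial>sphere_measure) = (\<integral>\<zeta>. f \<zeta> \<partial>sphere_measure)"
proof -
  let ?M = "sphere_measure :: (real^'n) measure"
  have inv: "rotation_invariant_sphere_measure ?M"
    by (rule rotation_invariant_sphere_measure)
  have lin: "linear T" and norm_T: "\<And>x. norm (T x) = norm x"
    using T by (auto simp: orthogonal_transformation)
  have bij: "bij T"
    using orthogonal_transformation_inj[OF T] orthogonal_transformation_surj[OF T] by (simp add: bij_def)
  have "T \<in> borel_measurable ?M"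
    by (intro measurable_sphere_continuous linear_continuous_on linear_linear[THEN iffD2] lin)
  then have Tm: "T \<in> measurable ?M ?M"
    unfolding measurable_cong_sets[OF refl sets_sphere_measure]
    by (rule measurable_restrict_space2[rotated]) (auto simp: norm_T)
  have "distr ?M ?M T = ?M"
  proof (rule measure_eqI)
    fix A assume "A \<in> sets (distr ?M ?M T)"
    then have A: "A \<in> sets ?M" by simp
    then have "A \<subseteq> sphere 0 1" using sets.sets_into_space by fastforce
    then have "T -` A \<inter> sphere 0 1 = T -` A" using norm_T by fastforce
    also have "\<dots> = inv T ` A" by (rule bij_vimage_eq_inv_image[OF bij])
    finally show "emeasure (distr ?M ?M T) A = emeasure ?M A"
      using inv orthogonal_transformation_inv[OF T] A
      by (simp add: emeasure_distr[OF Tm A] rotation_invariant_sphere_measure_def)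
  qed simp
  then show ?thesis
    using integral_distr[OF Tm measurable_sphere_continuous[OF f]] by simp
qed

text \<open>Differentiation under the integral sign. Compactness of the sphere makes the first-order Taylor
  remainder of the kernel small uniformly in the variable of integration, so the remainder may be
  integrated.\<close>

lemma has_derivative_sphere_integral:
  fixes k :: "'a::euclidean_space \<Rightarrow> real^'n \<Rightarrow> real"
    and F :: "real^'n \<Rightarrow> 'b::{banach, second_countable_topology}"
  assumes U: "open U" "x \<in> U"
    and k: "\<And>y \<zeta>. y \<in> U \<Longrightarrow> norm \<zeta> = 1 \<Longrightarrow> ((\<lambda>y. k y \<zeta>) has_derivative (\<lambda>h. g y \<zeta> \<bullet> h)) (at y)"
    and g: "continuous_on (U \<times> sphere 0 1) (\<lambda>(y, \<zeta>). g y \<zeta>)"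
    and kc: "\<And>y. y \<in> U \<Longrightarrow> continuous_on (sphere 0 1) (k y)"
    and F: "continuous_on (sphere 0 1) F"
  shows "((\<lambda>y. \<integral>\<zeta>. k y \<zeta> *\<^sub>R F \<zeta> \<partial>sphere_measure) has_derivative
          (\<lambda>h. \<integral>\<zeta>. (g x \<zeta> \<bullet> h) *\<^sub>R F \<zeta> \<partial>sphere_measure)) (at x)"
proof -
  have gc: "continuous_on (sphere 0 1) (g y)" if "y \<in> U" for y
  proof -
    have "continuous_on (sphere 0 1) ((\<lambda>(y, \<zeta>). g y \<zeta>) \<circ> (\<lambda>\<zeta>. (y, \<zeta>)))"
      by (intro continuous_on_compose continuous_intros continuous_on_subset[OF g]) (use that in auto)
    then show ?thesis by (simp add: o_def)
  qed
  have int_k: "integrable sphere_measure (\<lambda>\<zeta>. k y \<zeta> *\<^sub>R F \<zeta>)" if "y \<in> U" for y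
    by (intro integrable_sphere_continuous continuous_intros kc F that)
  have int_g: "integrable sphere_measure (\<lambda>\<zeta>. (g x \<zeta> \<bullet> h) *\<^sub>R F \<zeta>)" for h
    by (intro integrable_sphere_continuous continuous_intros gc F U)
  have "bounded (F ` sphere 0 1)"
    by (intro compact_imp_bounded compact_continuous_image F) simp
  then obtain B where B: "B > 0" "\<And>\<zeta>. norm \<zeta> = 1 \<Longrightarrow> norm (F \<zeta>) \<le> B"
    by (auto simp: bounded_pos)
  obtain d0 where d0: "d0 > 0" "cball x d0 \<subseteq> U"
    using U open_contains_cball by blast
  have "linear (\<lambda>h. \<integral>\<zeta>. (g x \<zeta> \<bullet> h) *\<^sub>R F \<zeta> \<partial>sphere_measure)"
    using int_g by (intro linearI) (simp_all add: inner_right_distrib scaleR_left_distrib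
        Bochner_Integration.integral_add flip: scaleR_scaleR)
  moreover have "\<exists>d>0. \<forall>y. norm (y - x) < d \<longrightarrow>
      norm ((\<integral>\<zeta>. k y \<zeta> *\<^sub>R F \<zeta> \<partial>sphere_measure) - (\<integral>\<zeta>. k x \<zeta> *\<^sub>R F \<zeta> \<partial>sphere_measure)
          - (\<integral>\<zeta>. (g x \<zeta> \<bullet> (y - x)) *\<^sub>R F \<zeta> \<partial>sphere_measure)) \<le> e * norm (y - x)"
    if e: "e > 0" for e
  proof -
    have "uniformly_continuous_on (cball x d0 \<times> sphere (0::real^'n) 1) (\<lambda>(y, \<zeta>). g y \<zeta>)"
      by (intro compact_uniformly_continuous continuous_on_subset[OF g] compact_Times)
         (use d0 in auto)
    then obtain d1 where d1: "d1 > 0"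
      "\<And>y z \<zeta>. y \<in> cball x d0 \<Longrightarrow> z \<in> cball x d0 \<Longrightarrow> norm \<zeta> = 1 \<Longrightarrow> dist y z < d1 \<Longrightarrow> dist (g y \<zeta>) (g z \<zeta>) < e / B"
      unfolding uniformly_continuous_on_def
      using divide_pos_pos[OF e \<open>B > 0\<close>] by (fastforce simp: dist_Pair_Pair)
    define d where "d = min d0 d1"
    have d: "d > 0" "ball x d \<subseteq> cball x d0" using d0 d1 by (auto simp: d_def)
    have dU: "w \<in> U" "w \<in> cball x d0" "dist w x < d1" if "w \<in> ball x d" for w
      using that d(2) d0(2) by (auto simp: d_def dist_commute)
    have "norm ((\<integral>\<zeta>. k y \<zeta> *\<^sub>R F \<zeta> \<partial>sphere_measure) - (\<integral>\<zeta>. k x \<zeta> *\<^sub>R F \<zeta> \<partial>sphere_measure)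
          - (\<integral>\<zeta>. (g x \<zeta> \<bullet> (y - x)) *\<^sub>R F \<zeta> \<partial>sphere_measure)) \<le> e * norm (y - x)"
      if y: "norm (y - x) < d" for y
    proof -
      have yU: "y \<in> U" using y by (intro dU) (simp add: dist_norm norm_minus_commute)
      \<comment> \<open>The mean value inequality, on a ball on which \<open>g\<close> varies by less than \<open>e / B\<close>.\<close>
      have pt: "norm (k y \<zeta> - k x \<zeta> - g x \<zeta> \<bullet> (y - x)) \<le> norm (y - x) * (e / B)" if z: "norm \<zeta> = 1" for \<zeta>
      proof (rule differentiable_bound_linearization[where S = "ball x d" and f' = "\<lambda>y h. g y \<zeta> \<bullet> h"])
        show "x + t *\<^sub>R (y - x) \<in> ball x d" if "t \<in> {0..1}" for t
        proof -
          have "t * norm (y - x) \<le> norm (y - x)" using that by (simp add: mult_left_le_one_le)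
          then show ?thesis using that y by (simp add: dist_norm)
        qed
        show "((\<lambda>y. k y \<zeta>) has_derivative (\<lambda>h. g w \<zeta> \<bullet> h)) (at w within ball x d)" if "w \<in> ball x d" for w
          by (rule has_derivative_at_withinI[OF k[OF dU(1)[OF that] z]])
        show "onorm ((\<lambda>h. g w \<zeta> \<bullet> h) - (\<lambda>h. g x \<zeta> \<bullet> h)) \<le> e / B" if "w \<in> ball x d" for w
        proof (rule onorm_bound)
          have "dist (g w \<zeta>) (g x \<zeta>) < e / B"
            by (rule d1(2)[OF dU(2)[OF that] _ z dU(3)[OF that]]) (use d0 in simp)
          then have "norm (g w \<zeta> - g x \<zeta>) \<le> e / B" by (simp add: dist_norm)
          then have "norm (g w \<zeta> - g x \<zeta>) * norm h \<le> e / B * norm h" for h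
            by (intro mult_right_mono) auto
          then have "\<bar>(g w \<zeta> - g x \<zeta>) \<bullet> h\<bar> \<le> e / B * norm h" for h
            using Cauchy_Schwarz_ineq2[of "g w \<zeta> - g x \<zeta>" h] order_trans by blast
          then show "norm (((\<lambda>h. g w \<zeta> \<bullet> h) - (\<lambda>h. g x \<zeta> \<bullet> h)) h) \<le> e / B * norm h" for h
            by (simp add: inner_diff_left)
        qed (use e B in simp)
      qed (use d in auto)
      have "(\<integral>\<zeta>. k y \<zeta> *\<^sub>R F \<zeta> \<partial>sphere_measure) - (\<integral>\<zeta>. k x \<zeta> *\<^sub>R F \<zeta> \<partial>sphere_measure)
          - (\<integral>\<zeta>. (g x \<zeta> \<bullet> (y - x)) *\<^sub>R F \<zeta> \<partial>sphere_measure)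
        = (\<integral>\<zeta>. (k y \<zeta> - k x \<zeta> - g x \<zeta> \<bullet> (y - x)) *\<^sub>R F \<zeta> \<partial>sphere_measure)"
        using int_k[OF yU] int_k[OF U(2)] int_g[of "y - x"]
        by (simp add: scaleR_left_diff_distrib Bochner_Integration.integral_diff)
      also have "norm \<dots> \<le> e * norm (y - x)"
      proof (rule norm_sphere_integral_le)
        show "continuous_on (sphere 0 1) (\<lambda>\<zeta>. (k y \<zeta> - k x \<zeta> - g x \<zeta> \<bullet> (y - x)) *\<^sub>R F \<zeta>)"
          by (intro continuous_intros kc gc F U yU)
        fix \<zeta> :: "real^'n" assume z: "norm \<zeta> = 1"
        have "norm ((k y \<zeta> - k x \<zeta> - g x \<zeta> \<bullet> (y - x)) *\<^sub>R F \<zeta>) \<le> (norm (y - x) * (e / B)) * B"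
          unfolding norm_scaleR using pt[OF z] B(2)[OF z] e B(1)
          by (intro mult_mono) auto
        then show "norm ((k y \<zeta> - k x \<zeta> - g x \<zeta> \<bullet> (y - x)) *\<^sub>R F \<zeta>) \<le> e * norm (y - x)"
          using B(1) by (simp add: mult.commute)
      qed
      finally show ?thesis .
    qed
    then show ?thesis using d(1) by blast
  qed
  ultimately show ?thesis
    unfolding has_derivative_at_alt by (simp add: linear_conv_bounded_linear)
qed


section \<open>Gradients, Hessians and harmonic functions\<close>

text \<open>A gradient field together with its derivative carries the same information as the first two
  derivatives in \<^const>\<open>harmonic_on\<close>, but its values are vectors instead of linear forms, which makes
  products, radial functions and traces easy to compute.\<close>

definition has_grad_hess ::
  "('a::euclidean_space \<Rightarrow> real) \<Rightarrow> ('a \<Rightarrow> 'a) \<Rightarrow> ('a \<Rightarrow> 'a \<Rightarrow> 'a) \<Rightarrow> 'a set \<Rightarrow> bool" where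
  "has_grad_hess u g H U \<longleftrightarrow>
     (\<forall>x\<in>U. (u has_derivative (\<lambda>h. g x \<bullet> h)) (at x) \<and> (g has_derivative H x) (at x))"

definition lin_trace :: "('a::euclidean_space \<Rightarrow> 'a) \<Rightarrow> real" where
  "lin_trace L = (\<Sum>b\<in>Basis. L b \<bullet> b)"

lemma has_grad_hessD:
  assumes "has_grad_hess u g H U" "x \<in> U"
  shows "(u has_derivative (\<lambda>h. g x \<bullet> h)) (at x)" "(g has_derivative H x) (at x)"
  using assms by (auto simp: has_grad_hess_def)

lemma has_grad_hess_subset: "has_grad_hess u g H U \<Longrightarrow> V \<subseteq> U \<Longrightarrow> has_grad_hess u g H V"
  by (auto simp: has_grad_hess_def)

lemma has_grad_hess_continuous_on:
  "has_grad_hess u g H U \<Longrightarrow> continuous_on U u"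
  "has_grad_hess u g H U \<Longrightarrow> continuous_on U g"
  using has_grad_hessD has_derivative_continuous
  by (auto intro!: continuous_at_imp_continuous_on) blast+

text \<open>Riesz representation turns the linear forms into vectors, and the second derivative into the
  Hessian.\<close>

lemma harmonic_on_iff_grad_hess:
  fixes u :: "'a::euclidean_space \<Rightarrow> real"
  shows "u harmonic_on U \<longleftrightarrow>
    (\<exists>g H. has_grad_hess u g H U \<and> (\<forall>h. continuous_on U (\<lambda>x. H x h)) \<and> (\<forall>x\<in>U. lin_trace (H x) = 0))"
proof
  assume "u harmonic_on U"
  then obtain D :: "'a \<Rightarrow> 'a \<Rightarrow>\<^sub>L real" and D2 :: "'a \<Rightarrow> 'a \<Rightarrow>\<^sub>L 'a \<Rightarrow>\<^sub>L real"
    where D: "\<And>x. x \<in> U \<Longrightarrow> (u has_derivative blinfun_apply (D x)) (at x)"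
      and D2: "\<And>x. x \<in> U \<Longrightarrow> (D has_derivative blinfun_apply (D2 x)) (at x)"
      and cont: "continuous_on U D2"
      and tr: "\<And>x. x \<in> U \<Longrightarrow> (\<Sum>b\<in>Basis. blinfun_apply (blinfun_apply (D2 x) b) b) = 0"
    unfolding harmonic_on_def by blast
  define g where "g x = (\<Sum>b\<in>Basis. blinfun_apply (D x) b *\<^sub>R b)" for x
  define H where "H x h = (\<Sum>b\<in>Basis. blinfun_apply (blinfun_apply (D2 x) h) b *\<^sub>R b)" for x h
  have g: "g x \<bullet> h = blinfun_apply (D x) h" for x h
  proof -
    have "blinfun_apply (D x) h = blinfun_apply (D x) (\<Sum>b\<in>Basis. (h \<bullet> b) *\<^sub>R b)"
      by (simp add: euclidean_representation)
    also have "\<dots> = g x \<bullet> h"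
      by (simp add: g_def blinfun.sum_right blinfun.scaleR_right inner_sum_left inner_commute[of h] mult.commute)
    finally show ?thesis by simp
  qed
  have "has_grad_hess u g H U"
    unfolding has_grad_hess_def
  proof (intro ballI conjI)
    fix x assume x: "x \<in> U"
    show "(u has_derivative (\<lambda>h. g x \<bullet> h)) (at x)" using D[OF x] by (simp add: g)
    show "(g has_derivative H x) (at x)"
      unfolding g_def H_def
      by (auto intro!: derivative_eq_intros D2[OF x] simp: blinfun.zero_right)
  qed
  moreover have "continuous_on U (\<lambda>x. H x h)" for h
    unfolding H_def by (intro continuous_intros cont)
  moreover have "lin_trace (H x) = 0" if "x \<in> U" for x
    using tr[OF that] by (simp add: lin_trace_def H_def inner_sum_left_Basis)
  ultimately show "\<exists>g H. has_grad_hess u g H U \<and> (\<forall>h. continuous_on U (\<lambda>x. H x h)) \<and> (\<forall>x\<in>U. lin_trace (H x) = 0)"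
    by blast
next
  assume "\<exists>g H. has_grad_hess u g H U \<and> (\<forall>h. continuous_on U (\<lambda>x. H x h)) \<and> (\<forall>x\<in>U. lin_trace (H x) = 0)"
  then obtain g H where gH: "has_grad_hess u g H U"
    and cont: "\<And>h. continuous_on U (\<lambda>x. H x h)" and tr: "\<And>x. x \<in> U \<Longrightarrow> lin_trace (H x) = 0"
    by blast
  define D where "D x = blinfun_inner_right (g x)" for x
  define D2 where "D2 x = Blinfun (\<lambda>h. blinfun_inner_right (H x h))" for x
  have D2: "blinfun_apply (D2 x) h = blinfun_inner_right (H x h)" if "x \<in> U" for x h
  proof -
    have "bounded_linear (H x)"
      using has_grad_hessD(2)[OF gH that] by (rule has_derivative_bounded_linear)
    then have "bounded_linear (\<lambda>h. blinfun_inner_right (H x h))"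
      by (rule bounded_linear_compose[OF bounded_linear_blinfun_inner_right])
    then show ?thesis by (simp add: D2_def bounded_linear_Blinfun_apply)
  qed
  show "u harmonic_on U"
    unfolding harmonic_on_def
  proof (intro exI[of _ D] exI[of _ D2] conjI ballI)
    fix x assume x: "x \<in> U"
    show "(u has_derivative blinfun_apply (D x)) (at x)"
      using has_grad_hessD(1)[OF gH x] by (simp add: D_def)
    have "(D has_derivative (\<lambda>h. blinfun_inner_right (H x h))) (at x)"
      unfolding D_def
      by (rule bounded_linear.has_derivative[OF bounded_linear_blinfun_inner_right has_grad_hessD(2)[OF gH x]])
    then show "(D has_derivative blinfun_apply (D2 x)) (at x)"
      by (simp add: D2[OF x, abs_def])
    show "(\<Sum>b\<in>Basis. blinfun_apply (blinfun_apply (D2 x) b) b) = 0"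
      using tr[OF x] by (simp add: D2[OF x] lin_trace_def)
  next
    show "continuous_on U D2"
      by (intro continuous_on_blinfun_componentwise) (auto simp: D2 cong: continuous_on_cong intro!: continuous_intros cont)
  qed
qed

lemma has_grad_hess_cmult:
  assumes "has_grad_hess u g H U"
  shows "has_grad_hess (\<lambda>x. c * u x) (\<lambda>x. c *\<^sub>R g x) (\<lambda>x h. c *\<^sub>R H x h) U"
  using assms unfolding has_grad_hess_def by (auto intro!: derivative_eq_intros)

lemma has_grad_hess_add:
  assumes "has_grad_hess u g H U" "has_grad_hess v k K U"
  shows "has_grad_hess (\<lambda>x. u x + v x) (\<lambda>x. g x + k x) (\<lambda>x h. H x h + K x h) U"
  using assms unfolding has_grad_hess_def by (auto intro!: derivative_eq_intros simp: inner_add_left)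

lemma has_grad_hess_mult:
  assumes "has_grad_hess u g H U" "has_grad_hess v k K U"
  shows "has_grad_hess (\<lambda>x. u x * v x) (\<lambda>x. u x *\<^sub>R k x + v x *\<^sub>R g x)
    (\<lambda>x h. (g x \<bullet> h) *\<^sub>R k x + u x *\<^sub>R K x h + (k x \<bullet> h) *\<^sub>R g x + v x *\<^sub>R H x h) U"
  using assms unfolding has_grad_hess_def
  by (auto intro!: derivative_eq_intros simp: algebra_simps inner_add_left)

text \<open>The chain rule through \<open>t = \<bar>x\<bar>\<^sup>2\<close>. The trace of this Hessian, \<open>4 t f''(t) + 2 n f'(t)\<close> in dimension \<open>n\<close>, is
  the Laplacian of a radial function in the variable \<open>t\<close>.\<close>

lemma has_grad_hess_radial:
  fixes U :: "'a::euclidean_space set"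
  assumes "\<And>x. x \<in> U \<Longrightarrow> (f has_real_derivative f1 (x \<bullet> x)) (at (x \<bullet> x))"
    and "\<And>x. x \<in> U \<Longrightarrow> (f1 has_real_derivative f2 (x \<bullet> x)) (at (x \<bullet> x))"
  shows "has_grad_hess (\<lambda>x. f (x \<bullet> x)) (\<lambda>x. (2 * f1 (x \<bullet> x)) *\<^sub>R x)
    (\<lambda>x h. (4 * f2 (x \<bullet> x) * (x \<bullet> h)) *\<^sub>R x + (2 * f1 (x \<bullet> x)) *\<^sub>R h) U"
  unfolding has_grad_hess_def
proof (intro ballI conjI)
  fix x assume x: "x \<in> U"
  have 1: "((\<lambda>y. f (y \<bullet> y)) has_derivative (\<lambda>h. f1 (x \<bullet> x) * (2 * (x \<bullet> h)))) (at x)"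
    by (rule has_derivative_eq_rhs[OF has_derivative_compose[of "\<lambda>y. y \<bullet> y", OF _ has_field_derivative_imp_has_derivative[OF assms(1)[OF x]]]])
       (auto intro!: derivative_eq_intros simp: inner_commute)
  have 2: "((\<lambda>y. f1 (y \<bullet> y)) has_derivative (\<lambda>h. f2 (x \<bullet> x) * (2 * (x \<bullet> h)))) (at x)"
    by (rule has_derivative_eq_rhs[OF has_derivative_compose[of "\<lambda>y. y \<bullet> y", OF _ has_field_derivative_imp_has_derivative[OF assms(2)[OF x]]]])
       (auto intro!: derivative_eq_intros simp: inner_commute)
  show "((\<lambda>x. f (x \<bullet> x)) has_derivative (\<lambda>h. (2 * f1 (x \<bullet> x)) *\<^sub>R x \<bullet> h)) (at x)"
    using 1 by (simp add: algebra_simps)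
  show "((\<lambda>x. (2 * f1 (x \<bullet> x)) *\<^sub>R x) has_derivative
         (\<lambda>h. (4 * f2 (x \<bullet> x) * (x \<bullet> h)) *\<^sub>R x + (2 * f1 (x \<bullet> x)) *\<^sub>R h)) (at x)"
    by (auto intro!: derivative_eq_intros 2 simp: algebra_simps)
qed

lemma lin_trace_simps:
  "lin_trace (\<lambda>h. L h + M h) = lin_trace L + lin_trace M"
  "lin_trace (\<lambda>h. L h - M h) = lin_trace L - lin_trace M"
  "lin_trace (\<lambda>h. c *\<^sub>R L h) = c * lin_trace L"
  by (simp_all add: lin_trace_def inner_add_left inner_diff_left sum.distrib sum_subtractf sum_distrib_left)

lemma lin_trace_rank_one:
  "lin_trace (\<lambda>h. (a \<bullet> h) *\<^sub>R b) = a \<bullet> b"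
  by (simp add: lin_trace_def euclidean_inner[of a b] mult.commute inner_commute)

lemma lin_trace_id: "lin_trace (\<lambda>h::'a::euclidean_space. h) = real DIM('a)"
  by (simp add: lin_trace_def)

lemma has_grad_hess_dilation:
  assumes "has_grad_hess u g H ((\<lambda>x. r *\<^sub>R x) ` U)"
  shows "has_grad_hess (\<lambda>x. u (r *\<^sub>R x)) (\<lambda>x. r *\<^sub>R g (r *\<^sub>R x)) (\<lambda>x h. (r * r) *\<^sub>R H (r *\<^sub>R x) h) U"
  unfolding has_grad_hess_def
proof (intro ballI conjI)
  fix x assume "x \<in> U"
  then have u: "(u has_derivative (\<lambda>h. g (r *\<^sub>R x) \<bullet> h)) (at (r *\<^sub>R x))"
    and g: "(g has_derivative H (r *\<^sub>R x)) (at (r *\<^sub>R x))"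
    using has_grad_hessD[OF assms, of "r *\<^sub>R x"] by auto
  have s: "((\<lambda>x. r *\<^sub>R x) has_derivative (\<lambda>h. r *\<^sub>R h)) (at x)"
    by (auto intro!: derivative_eq_intros)
  show "((\<lambda>x. u (r *\<^sub>R x)) has_derivative (\<lambda>h. r *\<^sub>R g (r *\<^sub>R x) \<bullet> h)) (at x)"
    using has_derivative_compose[OF s u] by simp
  have "((\<lambda>x. r *\<^sub>R g (r *\<^sub>R x)) has_derivative (\<lambda>h. r *\<^sub>R H (r *\<^sub>R x) (r *\<^sub>R h))) (at x)"
    by (intro has_derivative_scaleR_right has_derivative_compose[OF s g])
  then show "((\<lambda>x. r *\<^sub>R g (r *\<^sub>R x)) has_derivative (\<lambda>h. (r * r) *\<^sub>R H (r *\<^sub>R x) h)) (at x)"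
    using linear_scale[OF has_derivative_linear[OF g]] by simp
qed


section \<open>Maximum principles\<close>

text \<open>The second derivative test along each line through the maximum: a positive second derivative would
  make the first derivative positive, and hence the function increasing, on one side.\<close>

lemma grad_hess_at_local_max:
  fixes u :: "'a::euclidean_space \<Rightarrow> real"
  assumes gh: "has_grad_hess u g H U" and U: "open U" "x \<in> U"
    and max: "\<And>y. y \<in> U \<Longrightarrow> u y \<le> u x"
  shows "g x = 0" "H x b \<bullet> b \<le> 0"
proof -
  have "(\<lambda>h. g x \<bullet> h) = (\<lambda>h. 0)"
    by (rule differential_zero_maxmin[OF U(2,1) has_grad_hessD(1)[OF gh U(2)]]) (use max in auto)
  then show g0: "g x = 0"
    by (metis inner_eq_zero_iff)
  define f where "f t = u (x + t *\<^sub>R b)" for t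
  define f' where "f' t = g (x + t *\<^sub>R b) \<bullet> b" for t
  have "continuous_on UNIV (\<lambda>t. x + t *\<^sub>R b)" by (intro continuous_intros)
  then have "open ((\<lambda>t::real. x + t *\<^sub>R b) -` U)"
    using U(1) by (simp add: continuous_on_open_vimage)
  moreover have "0 \<in> (\<lambda>t::real. x + t *\<^sub>R b) -` U" using U by simp
  ultimately obtain d where "d > 0" "ball 0 d \<subseteq> (\<lambda>t::real. x + t *\<^sub>R b) -` U"
    using open_contains_ball by blast
  then have d: "d > 0" "\<And>t. \<bar>t\<bar> < d \<Longrightarrow> x + t *\<^sub>R b \<in> U"
    by (auto simp: subset_iff dist_real_def)
  have line: "((\<lambda>t. x + t *\<^sub>R b) has_derivative (\<lambda>s. s *\<^sub>R b)) (at t)" for t :: real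
    by (auto intro!: derivative_eq_intros)
  have f: "(f has_real_derivative f' t) (at t)" if "\<bar>t\<bar> < d" for t
    unfolding has_field_derivative_def f_def f'_def
    using has_derivative_compose[OF line has_grad_hessD(1)[OF gh d(2)[OF that]]]
    by (simp add: mult.commute[of _ "g _ \<bullet> b"])
  have f'0: "(f' has_real_derivative H x b \<bullet> b) (at 0)"
  proof -
    have H: "(g has_derivative H x) (at (x + 0 *\<^sub>R b))"
      using has_grad_hessD(2)[OF gh U(2)] by simp
    have "(f' has_derivative (\<lambda>s. H x (s *\<^sub>R b) \<bullet> b)) (at 0)"
      unfolding f'_def by (intro has_derivative_inner_left has_derivative_compose[OF line H])
    then show ?thesis
      by (simp add: has_field_derivative_def linear_scale[OF has_derivative_linear[OF H]] mult.commute[of _ "_ \<bullet> b"])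
  qed
  show "H x b \<bullet> b \<le> 0"
  proof (rule ccontr)
    assume "\<not> H x b \<bullet> b \<le> 0"
    then obtain e where e: "e > 0" "\<And>h. 0 < h \<Longrightarrow> h < e \<Longrightarrow> f' 0 < f' h"
      using DERIV_pos_inc_right[OF f'0] by auto
    have f'00: "f' 0 = 0" by (simp add: f'_def g0)
    define h where "h = min d e / 2"
    have h: "0 < h" "h < d" "h < e" using d e by (auto simp: h_def)
    have "f 0 < f h"
    proof (rule DERIV_pos_imp_increasing_open[OF h(1)])
      show "\<exists>y. DERIV f t :> y \<and> y > 0" if "0 < t" "t < h" for t
        using f[of t] e(2)[of t] that h f'00 by auto
      show "continuous_on {0..h} f"
        by (rule DERIV_atLeastAtMost_imp_continuous_on) (use f h in force)
    qed
    then show False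
      using max[of "x + h *\<^sub>R b"] d(2)[of h] h by (simp add: f_def)
  qed
qed

text \<open>A positive maximum in the interior is a critical point at which the Hessian has nonpositive trace, so
  it is enough to exclude that. In this form the principle covers equations
  \<open>a \<Delta>u = b \<bullet> \<nabla>u + c u\<close> with \<open>a, c > 0\<close>, whose first-order term drops out at a critical point, and, after
  a perturbation, Laplace's equation.\<close>

lemma maximum_principle:
  fixes u :: "'a::euclidean_space \<Rightarrow> real"
  assumes gh: "has_grad_hess u g H (ball 0 r)" and cont: "continuous_on (cball 0 r) u"
    and bdry: "\<And>x. norm x = r \<Longrightarrow> u x \<le> 0"
    and pos: "\<And>x. norm x < r \<Longrightarrow> u x > 0 \<Longrightarrow> g x = 0 \<Longrightarrow> lin_trace (H x) > 0"
    and x: "norm x \<le> r"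
  shows "u x \<le> 0"
proof (rule ccontr)
  assume ux: "\<not> u x \<le> 0"
  obtain z where z: "z \<in> cball 0 r" "\<And>y. y \<in> cball 0 r \<Longrightarrow> u y \<le> u z"
    using continuous_attains_sup[OF compact_cball _ cont] x by (metis empty_iff mem_cball_0)
  have uz: "u z > 0" using z(2)[of x] x ux by simp
  then have zr: "norm z < r" using bdry[of z] z(1) by force
  have "g z = 0" "\<And>b. H z b \<bullet> b \<le> 0"
    using grad_hess_at_local_max[OF gh open_ball] zr z(2) by auto
  then show False
    using pos[OF zr uz] by (simp add: lin_trace_def sum_nonpos leD)
qed

text \<open>Adding \<open>\<epsilon> \<bar>x\<bar>\<^sup>2\<close> makes the Laplacian strictly positive.\<close>

lemma maximum_principle_harmonic:
  fixes u :: "'a::euclidean_space \<Rightarrow> real"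
  assumes gh: "has_grad_hess u g H (ball 0 r)" and cont: "continuous_on (cball 0 r) u"
    and harm: "\<And>x. norm x < r \<Longrightarrow> lin_trace (H x) = 0"
    and bdry: "\<And>x. norm x = r \<Longrightarrow> u x \<le> c"
    and x: "norm x \<le> r"
  shows "u x \<le> c"
proof -
  have r: "r \<ge> 0" using x norm_ge_zero order_trans by blast
  have *: "u x \<le> c + e * r\<^sup>2" if e: "e > 0" for e
  proof -
    have q: "has_grad_hess (\<lambda>x. (\<lambda>t. e * t - c - e * r\<^sup>2) (x \<bullet> x)) (\<lambda>x. (2 * (\<lambda>t. e) (x \<bullet> x)) *\<^sub>R x)
      (\<lambda>x h. (4 * (\<lambda>t. 0) (x \<bullet> x) * (x \<bullet> h)) *\<^sub>R x + (2 * (\<lambda>t. e) (x \<bullet> x)) *\<^sub>R h) (ball (0::'a) r)"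
      by (rule has_grad_hess_radial) (auto intro!: derivative_eq_intros)
    have "u x + (e * (x \<bullet> x) - c - e * r\<^sup>2) \<le> 0"
    proof (rule maximum_principle[OF has_grad_hess_add[OF gh q]])
      show "u x + (e * (x \<bullet> x) - c - e * r\<^sup>2) \<le> 0" if "norm x = r" for x
        using bdry[OF that] that by (simp add: dot_square_norm)
      show "lin_trace (\<lambda>h. H x h + ((4 * 0 * (x \<bullet> h)) *\<^sub>R x + (2 * e) *\<^sub>R h)) > 0" if "norm x < r" for x
        using harm[OF that] e by (simp add: lin_trace_simps lin_trace_id)
      show "continuous_on (cball 0 r) (\<lambda>x. u x + (e * (x \<bullet> x) - c - e * r\<^sup>2))"
        by (intro continuous_intros cont)
    qed (use x in auto)
    then show ?thesis using e inner_ge_zero[of x] mult_nonneg_nonneg[of e "x \<bullet> x"] by linarith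
  qed
  show ?thesis
  proof (rule field_le_epsilon)
    fix d :: real assume d: "d > 0"
    have "u x \<le> c + d / (r\<^sup>2 + 1) * r\<^sup>2"
      by (rule *) (use d in \<open>simp add: add_nonneg_pos\<close>)
    also have "d / (r\<^sup>2 + 1) * r\<^sup>2 \<le> d"
      using d add_nonneg_pos[OF zero_le_power2[of r] zero_less_one] by (simp add: divide_simps)
    finally show "u x \<le> c + d" by simp
  qed
qed

lemma harmonic_abs_le:
  fixes u :: "'a::euclidean_space \<Rightarrow> real"
  assumes gh: "has_grad_hess u g H (ball 0 r)" and cont: "continuous_on (cball 0 r) u"
    and harm: "\<And>x. norm x < r \<Longrightarrow> lin_trace (H x) = 0"
    and bdry: "\<And>x. norm x = r \<Longrightarrow> \<bar>u x\<bar> \<le> c"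
    and x: "norm x \<le> r"
  shows "\<bar>u x\<bar> \<le> c"
proof -
  have "u x \<le> c"
    by (rule maximum_principle_harmonic[OF gh cont harm _ x]) (use bdry in \<open>auto simp: abs_le_iff\<close>)
  moreover have "(-1) * u x \<le> c"
  proof (rule maximum_principle_harmonic[OF has_grad_hess_cmult[OF gh] _ _ _ x])
    show "continuous_on (cball 0 r) (\<lambda>x. (-1) * u x)" by (intro continuous_intros cont)
    show "lin_trace (\<lambda>h. (-1) *\<^sub>R H y h) = 0" if "norm y < r" for y
      unfolding lin_trace_simps using harm[OF that] by simp
    show "(-1) * u y \<le> c" if "norm y = r" for y
      using bdry[OF that] by (simp add: abs_le_iff)
  qed
  ultimately show ?thesis by simp
qed


section \<open>Riesz potentials of the sphere\<close>

lemma norm_less_1_iff: "norm x < 1 \<longleftrightarrow> x \<bullet> x < (1::real)" for x :: "'a::real_inner"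
  by (simp add: norm_eq_sqrt_inner)

text \<open>The integral of \<open>\<bar>x - \<zeta>\<bar>\<^bsup>-2s\<^esup> F(\<zeta>)\<close>, with the squared distance as the base so that it is smooth in \<open>x\<close>.
  Vector-valued densities are admitted because the gradient of a potential with density \<open>f\<close> involves
  the potential with density \<open>f(\<zeta>) \<zeta>\<close>.\<close>

definition sphere_potential ::
  "real \<Rightarrow> (real^'n \<Rightarrow> 'b::{banach, second_countable_topology}) \<Rightarrow> real^'n \<Rightarrow> 'b" where
  "sphere_potential s F x = (\<integral>\<zeta>. ((x - \<zeta>) \<bullet> (x - \<zeta>)) powr (-s) *\<^sub>R F \<zeta> \<partial>sphere_measure)"

lemma dist_sphere_pos:
  fixes x \<zeta> :: "'a::real_inner"
  assumes "norm x < 1" "norm \<zeta> = 1"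
  shows "0 < (x - \<zeta>) \<bullet> (x - \<zeta>)"
  using assms by auto

lemma continuous_on_dist_sphere_powr [continuous_intros]:
  fixes x :: "'a::real_inner"
  assumes "norm x < 1"
  shows "continuous_on (sphere 0 1) (\<lambda>\<zeta>. ((x - \<zeta>) \<bullet> (x - \<zeta>)) powr a)"
  using dist_sphere_pos[OF assms] by (intro continuous_intros) force+

lemma integrable_sphere_potential:
  fixes x :: "real^'n" and F :: "real^'n \<Rightarrow> 'b::{banach, second_countable_topology}"
  assumes "norm x < 1" "continuous_on (sphere 0 1) F"
  shows "integrable sphere_measure (\<lambda>\<zeta>. ((x - \<zeta>) \<bullet> (x - \<zeta>)) powr a *\<^sub>R F \<zeta>)"
  by (intro integrable_sphere_continuous continuous_intros assms)

definition sphere_potential_deriv ::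
  "real \<Rightarrow> (real^'n \<Rightarrow> 'b::{banach, second_countable_topology}) \<Rightarrow> real^'n \<Rightarrow> real^'n \<Rightarrow> 'b" where
  "sphere_potential_deriv s F x h =
     (\<integral>\<zeta>. (- 2 * s * ((x - \<zeta>) \<bullet> (x - \<zeta>)) powr (- s - 1) * ((x - \<zeta>) \<bullet> h)) *\<^sub>R F \<zeta> \<partial>sphere_measure)"

lemma has_derivative_sphere_potential:
  fixes F :: "real^'n \<Rightarrow> 'b::{banach, second_countable_topology}"
  assumes x: "norm x < 1" and F: "continuous_on (sphere 0 1) F"
  shows "(sphere_potential s F has_derivative sphere_potential_deriv s F x) (at x)"
proof -
  let ?g = "\<lambda>y \<zeta>. (- 2 * s * ((y - \<zeta>) \<bullet> (y - \<zeta>)) powr (- s - 1)) *\<^sub>R (y - \<zeta>)"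
  have "((\<lambda>y. \<integral>\<zeta>. ((y - \<zeta>) \<bullet> (y - \<zeta>)) powr (-s) *\<^sub>R F \<zeta> \<partial>sphere_measure) has_derivative
          (\<lambda>h. \<integral>\<zeta>. (?g x \<zeta> \<bullet> h) *\<^sub>R F \<zeta> \<partial>sphere_measure)) (at x)"
  proof (rule has_derivative_sphere_integral[OF open_ball _ _ _ _ F])
    show "x \<in> ball 0 1" using x by simp
    show "continuous_on (sphere 0 1) (\<lambda>\<zeta>. ((y - \<zeta>) \<bullet> (y - \<zeta>)) powr (-s))" if "y \<in> ball 0 1" for y :: "real^'n"
      by (rule continuous_on_dist_sphere_powr) (use that in simp)
    show "continuous_on (ball 0 1 \<times> sphere 0 1) (\<lambda>(y::real^'n, \<zeta>). ?g y \<zeta>)"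
      unfolding case_prod_beta
      by (intro continuous_intros) (use dist_sphere_pos in force)
    show "((\<lambda>y. ((y - \<zeta>) \<bullet> (y - \<zeta>)) powr (-s)) has_derivative (\<lambda>h. ?g y \<zeta> \<bullet> h)) (at y)"
      if "y \<in> ball 0 1" "norm \<zeta> = 1" for y \<zeta> :: "real^'n"
    proof -
      have pos: "0 < (y - \<zeta>) \<bullet> (y - \<zeta>)" using dist_sphere_pos that by simp
      have "((\<lambda>y. (y - \<zeta>) \<bullet> (y - \<zeta>)) has_derivative (\<lambda>h. 2 * ((y - \<zeta>) \<bullet> h))) (at y)"
        by (auto intro!: derivative_eq_intros simp: inner_commute)
      from has_derivative_compose[OF this has_real_derivative_powr[OF pos, of "-s", unfolded has_field_derivative_def]]
      show ?thesis by (simp add: mult_ac)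
    qed
  qed
  then show ?thesis
    by (simp add: sphere_potential_def[abs_def] sphere_potential_deriv_def[abs_def])
qed

lemma continuous_on_sphere_potential:
  fixes F :: "real^'n \<Rightarrow> 'b::{banach, second_countable_topology}"
  assumes F: "continuous_on (sphere 0 1) F"
  shows "continuous_on (ball 0 1) (sphere_potential s F)"
  by (rule has_derivative_continuous_on[OF has_derivative_at_withinI[OF has_derivative_sphere_potential[OF _ F]]]) simp

text \<open>Splitting \<open>(x - \<zeta>) \<bullet> h\<close> expresses the derivative by potentials of order \<open>s + 1\<close>, so that it can be
  differentiated again and is seen to be continuous.\<close>

lemma sphere_potential_deriv_eq:
  fixes F :: "real^'n \<Rightarrow> 'b::{banach, second_countable_topology}"
  assumes x: "norm x < 1" and F: "continuous_on (sphere 0 1) F"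
  shows "sphere_potential_deriv s F x h =
    (- 2 * s) *\<^sub>R ((x \<bullet> h) *\<^sub>R sphere_potential (s + 1) F x - sphere_potential (s + 1) (\<lambda>\<zeta>. (\<zeta> \<bullet> h) *\<^sub>R F \<zeta>) x)"
proof -
  have "continuous_on (sphere 0 1) (\<lambda>\<zeta>. (\<zeta> \<bullet> h) *\<^sub>R F \<zeta>)"
    by (intro continuous_intros F)
  note int = integrable_sphere_potential[OF x F, of "- s - 1"] integrable_sphere_potential[OF x this, of "- s - 1"]
  have "sphere_potential_deriv s F x h =
    (\<integral>\<zeta>. (- 2 * s) *\<^sub>R ((x \<bullet> h) *\<^sub>R (((x - \<zeta>) \<bullet> (x - \<zeta>)) powr (- s - 1) *\<^sub>R F \<zeta>)
        - ((x - \<zeta>) \<bullet> (x - \<zeta>)) powr (- s - 1) *\<^sub>R ((\<zeta> \<bullet> h) *\<^sub>R F \<zeta>)) \<partial>sphere_measure)"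
    unfolding sphere_potential_deriv_def
    by (rule sphere_integral_cong)
       (simp only: scaleR_scaleR scaleR_diff_left[symmetric], simp add: inner_diff_left algebra_simps)
  also have "\<dots> = (- 2 * s) *\<^sub>R ((x \<bullet> h) *\<^sub>R (\<integral>\<zeta>. ((x - \<zeta>) \<bullet> (x - \<zeta>)) powr (- s - 1) *\<^sub>R F \<zeta> \<partial>sphere_measure)
      - (\<integral>\<zeta>. ((x - \<zeta>) \<bullet> (x - \<zeta>)) powr (- s - 1) *\<^sub>R ((\<zeta> \<bullet> h) *\<^sub>R F \<zeta>) \<partial>sphere_measure))"
    by (subst integral_scaleR_right, subst Bochner_Integration.integral_diff)
       (use int in \<open>simp_all only: integrable_scaleR_right integral_scaleR_right\<close>)
  finally show ?thesis
    by (simp add: sphere_potential_def)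
qed

text \<open>Let \<open>V\<close> be the potential of order \<open>s + 1\<close> of the same density. Differentiating the kernel \<open>k\<^bsup>-s\<^esup>\<close> with
  \<open>k = \<bar>x - \<zeta>\<bar>\<^sup>2\<close> twice gives \<open>\<Delta>U = 4 s (s + 1 - n/2) V\<close>. On the sphere \<open>2 x \<bullet> (x - \<zeta>) = k - (1 - \<bar>x\<bar>\<^sup>2)\<close>, and
  therefore \<open>x \<bullet> \<nabla>U = -s U + s (1 - \<bar>x\<bar>\<^sup>2) V\<close>. Eliminating \<open>V\<close> yields a closed equation for \<open>U\<close>.\<close>

lemma sphere_potential_equation:
  fixes f :: "real^'n \<Rightarrow> real"
  assumes f: "continuous_on (sphere 0 1) f"
  obtains G H where "has_grad_hess (sphere_potential s f) G H (ball 0 1)"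
    and "\<And>h. continuous_on (ball 0 1) (\<lambda>x. H x h)"
    and "\<And>x. norm x < 1 \<Longrightarrow> (1 - x \<bullet> x) * lin_trace (H x) =
           4 * (s + 1 - real CARD('n) / 2) * (x \<bullet> G x + s * sphere_potential s f x)"
proof -
  let ?n = "real CARD('n)"
  let ?F = "\<lambda>\<zeta>. f \<zeta> *\<^sub>R \<zeta>"
  let ?k = "\<lambda>x \<zeta>::real^'n. (x - \<zeta>) \<bullet> (x - \<zeta>)"
  have F: "continuous_on (sphere 0 1) ?F" by (intro continuous_intros f)
  define G where "G x = (-2 * s) *\<^sub>R (sphere_potential (s + 1) f x *\<^sub>R x - sphere_potential (s + 1) ?F x)" for x
  define H where "H x h = (-2 * s) *\<^sub>R (sphere_potential (s + 1) f x *\<^sub>R h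
      + (sphere_potential_deriv (s + 1) f x h *\<^sub>R x - sphere_potential_deriv (s + 1) ?F x h))" for x h
  have inner_F: "sphere_potential (s + 1) ?F x \<bullet> h = sphere_potential (s + 1) (\<lambda>\<zeta>. (\<zeta> \<bullet> h) *\<^sub>R f \<zeta>) x"
    if "norm x < 1" for x h
    unfolding sphere_potential_def
    by (subst integral_inner_left[symmetric]) (auto intro!: integrable_sphere_continuous continuous_intros f sphere_integral_cong simp: that)
  have G: "sphere_potential_deriv s f x h = G x \<bullet> h" if "norm x < 1" for x h
    using inner_F[OF that, of h] by (simp add: sphere_potential_deriv_eq[OF that f] G_def inner_diff_left mult.commute)
  have gh: "has_grad_hess (sphere_potential s f) G H (ball 0 1)"
    unfolding has_grad_hess_def
  proof (intro ballI conjI)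
    fix x :: "real^'n" assume "x \<in> ball 0 1"
    then have x: "norm x < 1" by simp
    show "(sphere_potential s f has_derivative (\<lambda>h. G x \<bullet> h)) (at x)"
      using has_derivative_sphere_potential[OF x f, of s] G[OF x] by (simp add: G[OF x, symmetric])
    show "(G has_derivative H x) (at x)"
      unfolding G_def[abs_def] H_def[abs_def]
      by (rule has_derivative_eq_rhs,
          rule has_derivative_scaleR_right[OF has_derivative_diff[OF has_derivative_scaleR[OF
            has_derivative_sphere_potential[OF x f] has_derivative_ident] has_derivative_sphere_potential[OF x F]]])
         (simp add: fun_eq_iff algebra_simps)
  qed
  moreover have "continuous_on (ball 0 1) (\<lambda>x. H x h)" for h
  proof -
    have "continuous_on (ball 0 1) (\<lambda>x. sphere_potential_deriv (s + 1) f x h)"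
      by (subst continuous_on_cong[OF refl sphere_potential_deriv_eq[OF _ f]])
         (auto intro!: continuous_intros continuous_on_sphere_potential f)
    moreover have "continuous_on (ball 0 1) (\<lambda>x. sphere_potential_deriv (s + 1) ?F x h)"
      by (subst continuous_on_cong[OF refl sphere_potential_deriv_eq[OF _ F]])
         (auto intro!: continuous_intros continuous_on_sphere_potential F f)
    ultimately show ?thesis
      unfolding H_def by (intro continuous_intros continuous_on_sphere_potential f)
  qed
  moreover have "(1 - x \<bullet> x) * lin_trace (H x) = 4 * (s + 1 - ?n / 2) * (x \<bullet> G x + s * sphere_potential s f x)"
    if x: "norm x < 1" for x
  proof -
    note pos = dist_sphere_pos[OF x]
    let ?c = "\<lambda>\<zeta>. -2 * (s + 1) * ?k x \<zeta> powr (- s - 2)"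
    have c: "continuous_on (sphere 0 1) ?c" by (intro continuous_intros x)
    have d: "sphere_potential_deriv (s + 1) F x h = (\<integral>\<zeta>. (?c \<zeta> * ((x - \<zeta>) \<bullet> h)) *\<^sub>R F \<zeta> \<partial>sphere_measure)"
      for F :: "real^'n \<Rightarrow> 'c::{banach,second_countable_topology}" and h
    proof -
      have e: "- (s + 1) - 1 = - s - 2" by simp
      show ?thesis unfolding sphere_potential_deriv_def e ..
    qed
    \<comment> \<open>The trace of the rank-one part of the kernel's Hessian; summing over the basis produces \<open>k\<close>.\<close>
    have "lin_trace (\<lambda>h. sphere_potential_deriv (s + 1) f x h *\<^sub>R x - sphere_potential_deriv (s + 1) ?F x h)
      = (\<Sum>b\<in>Basis. \<integral>\<zeta>. ?c \<zeta> * f \<zeta> * (((x - \<zeta>) \<bullet> b) * ((x - \<zeta>) \<bullet> b)) \<partial>sphere_measure)"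
      unfolding lin_trace_def
    proof (rule sum.cong[OF refl])
      fix b :: "real^'n" assume "b \<in> Basis"
      let ?e = "\<lambda>a \<zeta>. ?c \<zeta> * ((x - \<zeta>) \<bullet> b) * f \<zeta> * a \<zeta>"
      have int: "integrable sphere_measure (?e a)" if "continuous_on (sphere 0 1) a" for a
        by (intro integrable_sphere_continuous continuous_intros f x that)
      have 1: "sphere_potential_deriv (s + 1) ?F x b \<bullet> b = (\<integral>\<zeta>. ?e (\<lambda>\<zeta>. \<zeta> \<bullet> b) \<zeta> \<partial>sphere_measure)"
        unfolding d
        by (subst integral_inner_left[symmetric])
           (auto intro!: integrable_sphere_continuous continuous_intros c f sphere_integral_cong simp: x)
      have 2: "sphere_potential_deriv (s + 1) f x b *\<^sub>R x \<bullet> b = (\<integral>\<zeta>. ?e (\<lambda>\<zeta>. x \<bullet> b) \<zeta> \<partial>sphere_measure)"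
        unfolding d by simp
      have "(sphere_potential_deriv (s + 1) f x b *\<^sub>R x - sphere_potential_deriv (s + 1) ?F x b) \<bullet> b
         = (\<integral>\<zeta>. ?e (\<lambda>\<zeta>. x \<bullet> b) \<zeta> \<partial>sphere_measure) - (\<integral>\<zeta>. ?e (\<lambda>\<zeta>. \<zeta> \<bullet> b) \<zeta> \<partial>sphere_measure)"
        unfolding 1[symmetric] 2[symmetric] by (rule inner_diff_left)
      also have "\<dots> = (\<integral>\<zeta>. ?e (\<lambda>\<zeta>. x \<bullet> b) \<zeta> - ?e (\<lambda>\<zeta>. \<zeta> \<bullet> b) \<zeta> \<partial>sphere_measure)"
        by (rule Bochner_Integration.integral_diff[symmetric]) (intro int continuous_intros)+
      also have "\<dots> = (\<integral>\<zeta>. ?c \<zeta> * f \<zeta> * (((x - \<zeta>) \<bullet> b) * ((x - \<zeta>) \<bullet> b)) \<partial>sphere_measure)"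
        by (rule sphere_integral_cong) (simp only: right_diff_distrib[symmetric] inner_diff_left[symmetric], simp only: mult_ac)
      finally show "(sphere_potential_deriv (s + 1) f x b *\<^sub>R x - sphere_potential_deriv (s + 1) ?F x b) \<bullet> b
         = (\<integral>\<zeta>. ?c \<zeta> * f \<zeta> * (((x - \<zeta>) \<bullet> b) * ((x - \<zeta>) \<bullet> b)) \<partial>sphere_measure)" .
    qed
    also have "\<dots> = (\<integral>\<zeta>. (\<Sum>b\<in>Basis. ?c \<zeta> * f \<zeta> * (((x - \<zeta>) \<bullet> b) * ((x - \<zeta>) \<bullet> b))) \<partial>sphere_measure)"
      by (rule Bochner_Integration.integral_sum[symmetric])
         (auto intro!: integrable_sphere_continuous continuous_intros c f simp: x)
    also have "\<dots> = (\<integral>\<zeta>. (-2 * (s + 1)) *\<^sub>R (?k x \<zeta> powr (- (s + 1)) *\<^sub>R f \<zeta>) \<partial>sphere_measure)"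
    proof (rule sphere_integral_cong)
      fix \<zeta> :: "real^'n" assume z: "norm \<zeta> = 1"
      have "- (s + 1) = (- s - 2) + 1" by simp
      then have "?k x \<zeta> powr (- (s + 1)) = ?k x \<zeta> powr (- s - 2) * ?k x \<zeta>"
        using pos[OF z] by (simp only: powr_add powr_one less_imp_le)
      show "(\<Sum>b\<in>Basis. ?c \<zeta> * f \<zeta> * (((x - \<zeta>) \<bullet> b) * ((x - \<zeta>) \<bullet> b)))
          = (-2 * (s + 1)) *\<^sub>R (?k x \<zeta> powr (- (s + 1)) *\<^sub>R f \<zeta>)"
        unfolding \<open>?k x \<zeta> powr (- (s + 1)) = _\<close>
        by (simp add: sum_distrib_left[symmetric] euclidean_inner[of "x - \<zeta>" "x - \<zeta>", symmetric])
    qed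
    also have "\<dots> = -2 * (s + 1) * sphere_potential (s + 1) f x"
      by (simp add: sphere_potential_def)
    finally have tr: "lin_trace (H x) = (-2 * s) * (?n - 2 * (s + 1)) * sphere_potential (s + 1) f x"
      unfolding H_def by (simp only: lin_trace_simps lin_trace_id) (simp add: algebra_simps)
    have "x \<bullet> G x = sphere_potential_deriv s f x x"
      using G[OF x, of x] by (simp add: inner_commute)
    also have "\<dots> = (\<integral>\<zeta>. (- s) * (?k x \<zeta> powr (- s) *\<^sub>R f \<zeta>)
        + (s * (1 - x \<bullet> x)) * (?k x \<zeta> powr (- (s + 1)) *\<^sub>R f \<zeta>) \<partial>sphere_measure)"
      unfolding sphere_potential_deriv_def
    proof (rule sphere_integral_cong)
      fix \<zeta> :: "real^'n" assume z: "norm \<zeta> = 1"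
      have "?k x \<zeta> powr (- s) = ?k x \<zeta> powr (- (s + 1)) * ?k x \<zeta>"
        using pos[OF z] powr_add[of "?k x \<zeta>" "- (s + 1)" 1] by (simp add: powr_one)
      moreover have "2 * ((x - \<zeta>) \<bullet> x) = ?k x \<zeta> - (\<zeta> \<bullet> \<zeta> - x \<bullet> x)"
        by (simp add: inner_diff_left inner_diff_right inner_commute)
      moreover have "\<zeta> \<bullet> \<zeta> = 1" using z by (simp add: dot_square_norm)
      moreover have "- s - 1 = - (s + 1)" by simp
      ultimately show "(- 2 * s * ?k x \<zeta> powr (- s - 1) * ((x - \<zeta>) \<bullet> x)) *\<^sub>R f \<zeta> =
         - s * (?k x \<zeta> powr (- s) *\<^sub>R f \<zeta>) + s * (1 - x \<bullet> x) * (?k x \<zeta> powr (- (s + 1)) *\<^sub>R f \<zeta>)"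
        unfolding real_scaleR_def by algebra
    qed
    also have "\<dots> = - s * sphere_potential s f x + s * (1 - x \<bullet> x) * sphere_potential (s + 1) f x"
      unfolding sphere_potential_def
      by (simp only: Bochner_Integration.integral_add integrable_mult_right integrable_sphere_potential[OF x f]
          integral_mult_right_zero)
    finally have eq: "x \<bullet> G x + s * sphere_potential s f x = s * (1 - x \<bullet> x) * sphere_potential (s + 1) f x"
      by simp
    show ?thesis unfolding tr eq by (simp add: algebra_simps)
  qed
  ultimately show ?thesis using that by blast
qed

lemma sphere_potential_rotation:
  fixes x :: "real^'n" and T :: "real^'n \<Rightarrow> real^'n"
  assumes T: "orthogonal_transformation T" and x: "norm x < 1"
  shows "sphere_potential s (\<lambda>_. 1 :: real) (T x) = sphere_potential s (\<lambda>_. 1) x"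
proof -
  have Tx: "norm (T x) < 1" using orthogonal_transformation_norm[OF T] x by simp
  have "(T x - T \<zeta>) \<bullet> (T x - T \<zeta>) = (x - \<zeta>) \<bullet> (x - \<zeta>)" for \<zeta>
    using T linear_diff[OF orthogonal_transformation_linear[OF T], of x \<zeta>]
    by (metis orthogonal_transformation_def)
  then show ?thesis
    using sphere_integral_rotation[OF T continuous_on_dist_sphere_powr[OF Tx], of "-s"]
    by (simp add: sphere_potential_def)
qed

text \<open>The rotation taking \<open>x\<close> to \<open>y\<close> preserves the measure.\<close>

lemma sphere_potential_radial:
  fixes x y :: "real^'n"
  assumes "norm x = norm y" "norm x < 1"
  shows "sphere_potential s (\<lambda>_. 1 :: real) x = sphere_potential s (\<lambda>_. 1) y"
  using orthogonal_transformation_exists[OF assms(1)] sphere_potential_rotation[OF _ assms(2)] by metis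

lemma sphere_potential_one_pos:
  fixes x :: "real^'n"
  assumes x: "norm x < 1" and s: "s \<ge> 0"
  shows "0 < sphere_potential s (\<lambda>_. 1 :: real) x"
proof -
  have "(0::real) < 4 powr (-s)" by simp
  also have "\<dots> = (\<integral>(\<zeta>::real^'n). 4 powr (-s) \<partial>sphere_measure)" by simp
  also have "\<dots> \<le> (\<integral>\<zeta>. ((x - \<zeta>) \<bullet> (x - \<zeta>)) powr (-s) \<partial>sphere_measure)"
  proof (rule sphere_integral_mono)
    fix \<zeta> :: "real^'n" assume z: "norm \<zeta> = 1"
    have "norm (x - \<zeta>) \<le> 2" using norm_triangle_ineq4[of x \<zeta>] x z by simp
    then have "(x - \<zeta>) \<bullet> (x - \<zeta>) \<le> 4"
      using power_mono[of "norm (x - \<zeta>)" 2 2] by (simp add: dot_square_norm)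
    then show "4 powr (-s) \<le> ((x - \<zeta>) \<bullet> (x - \<zeta>)) powr (-s)"
      using dist_sphere_pos[OF x z] s by (intro powr_mono2') auto
  qed (auto intro!: continuous_intros continuous_on_dist_sphere_powr x)
  finally show ?thesis by (simp add: sphere_potential_def)
qed

lemma sphere_potential_one_at_0: "sphere_potential s (\<lambda>_. 1 :: real) (0::real^'n) = 1"
proof -
  have "sphere_potential s (\<lambda>_. 1 :: real) (0::real^'n) = (\<integral>(\<zeta>::real^'n). 1 \<partial>sphere_measure)"
    unfolding sphere_potential_def by (rule sphere_integral_cong) (simp add: dot_square_norm)
  then show ?thesis by simp
qed


section \<open>The Poisson integral\<close>

definition poisson_kernel :: "real^'n \<Rightarrow> real^'n \<Rightarrow> real" where
  "poisson_kernel x \<zeta> = (1 - x \<bullet> x) * ((x - \<zeta>) \<bullet> (x - \<zeta>)) powr (- (real CARD('n) / 2))"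

definition poisson_integral :: "(real^'n \<Rightarrow> real) \<Rightarrow> real^'n \<Rightarrow> real" where
  "poisson_integral f x = (\<integral>\<zeta>. poisson_kernel x \<zeta> * f \<zeta> \<partial>sphere_measure)"

lemma poisson_integral_eq_potential:
  fixes f :: "real^'n \<Rightarrow> real"
  shows "poisson_integral f x = (1 - x \<bullet> x) * sphere_potential (real CARD('n) / 2) f x"
  by (simp add: poisson_integral_def sphere_potential_def poisson_kernel_def mult.assoc)

lemma poisson_kernel_pos:
  assumes "norm x < 1" "norm \<zeta> = 1"
  shows "0 < poisson_kernel x \<zeta>"
  using assms dist_sphere_pos[OF assms] by (simp add: poisson_kernel_def norm_less_1_iff)

lemma continuous_on_poisson_kernel [continuous_intros]:
  "norm x < 1 \<Longrightarrow> continuous_on (sphere 0 1) (poisson_kernel x)"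
  unfolding poisson_kernel_def[abs_def] by (intro continuous_intros)

text \<open>Both sides depend on \<open>r\<close> and \<open>\<eta> \<bullet> \<zeta>\<close> only.\<close>

lemma poisson_kernel_commute:
  assumes "norm \<eta> = 1" "norm \<zeta> = 1"
  shows "poisson_kernel (r *\<^sub>R \<eta>) \<zeta> = poisson_kernel (r *\<^sub>R \<zeta>) \<eta>"
proof -
  have "\<eta> \<bullet> \<eta> = 1" "\<zeta> \<bullet> \<zeta> = 1" using assms by (simp_all add: dot_square_norm)
  then show ?thesis
    by (simp add: poisson_kernel_def inner_diff_left inner_diff_right inner_commute)
qed

text \<open>For \<open>s = n/2\<close> the equation of the potential reads \<open>(1 - \<bar>x\<bar>\<^sup>2) \<Delta>U = 4 x \<bullet> \<nabla>U + 2 n U\<close>. The right-hand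
  side is exactly what the product rule for \<open>(1 - \<bar>x\<bar>\<^sup>2) U\<close> subtracts.\<close>

lemma poisson_integral_harmonic:
  fixes f :: "real^'n \<Rightarrow> real"
  assumes f: "continuous_on (sphere 0 1) f"
  obtains g H where "has_grad_hess (poisson_integral f) g H (ball 0 1)"
    and "\<And>h. continuous_on (ball 0 1) (\<lambda>x. H x h)"
    and "\<And>x. norm x < 1 \<Longrightarrow> lin_trace (H x) = 0"
proof -
  let ?n = "real CARD('n)"
  let ?S = "sphere_potential (?n / 2) f"
  obtain G K where G: "has_grad_hess ?S G K (ball 0 1)"
    and K: "\<And>h. continuous_on (ball 0 1) (\<lambda>x. K x h)"
    and eq: "\<And>x. norm x < 1 \<Longrightarrow> (1 - x \<bullet> x) * lin_trace (K x) =
           4 * (?n / 2 + 1 - ?n / 2) * (x \<bullet> G x + ?n / 2 * ?S x)"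
    using sphere_potential_equation[OF f, of "?n / 2"] by metis
  have q: "has_grad_hess (\<lambda>x. (\<lambda>t. 1 - t) (x \<bullet> x)) (\<lambda>x. (2 * (\<lambda>t. -1) (x \<bullet> x)) *\<^sub>R x)
      (\<lambda>x h. (4 * (\<lambda>t. 0) (x \<bullet> x) * (x \<bullet> h)) *\<^sub>R x + (2 * (\<lambda>t. -1) (x \<bullet> x)) *\<^sub>R h) (ball (0::real^'n) 1)"
    by (rule has_grad_hess_radial) (auto intro!: derivative_eq_intros)
  have q': "has_grad_hess (\<lambda>x. 1 - x \<bullet> x) (\<lambda>x. (-2) *\<^sub>R x) (\<lambda>x h. (-2) *\<^sub>R h) (ball (0::real^'n) 1)"
    using q by simp
  let ?H = "\<lambda>x h. ((-2) *\<^sub>R x \<bullet> h) *\<^sub>R G x + (1 - x \<bullet> x) *\<^sub>R K x h + (G x \<bullet> h) *\<^sub>R ((-2) *\<^sub>R x) + ?S x *\<^sub>R (-2) *\<^sub>R h"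
  have "has_grad_hess (poisson_integral f) (\<lambda>x. (1 - x \<bullet> x) *\<^sub>R G x + ?S x *\<^sub>R (-2) *\<^sub>R x) ?H (ball 0 1)"
    using has_grad_hess_mult[OF q' G] by (simp only: poisson_integral_eq_potential[abs_def])
  moreover have "continuous_on (ball 0 1) (\<lambda>x. ?H x h)" for h
    by (intro continuous_intros K has_grad_hess_continuous_on[OF G])
  moreover have "lin_trace (?H x) = 0" if x: "norm x < 1" for x
  proof -
    have "lin_trace (?H x) = -4 * (x \<bullet> G x) + (1 - x \<bullet> x) * lin_trace (K x) - 2 * ?n * ?S x"
      by (simp only: lin_trace_simps lin_trace_rank_one lin_trace_id DIM_cart DIM_real)
         (simp add: inner_commute)
    then show ?thesis using eq[OF x] by (simp add: algebra_simps)
  qed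
  ultimately show ?thesis using that by blast
qed

text \<open>The total mass of the kernel is a radial harmonic function, hence constant on each sphere and, by the
  maximum principle, equal to its value at the centre.\<close>

lemma poisson_integral_one:
  fixes x :: "real^'n"
  assumes x: "norm x < 1"
  shows "poisson_integral (\<lambda>_. 1) x = 1"
proof -
  let ?P = "poisson_integral (\<lambda>_::real^'n. 1)"
  have one: "continuous_on (sphere 0 1) (\<lambda>_::real^'n. 1::real)" by simp
  obtain g H where gh: "has_grad_hess ?P g H (ball 0 1)"
    and tr: "\<And>x. norm x < 1 \<Longrightarrow> lin_trace (H x) = 0"
    using poisson_integral_harmonic[OF one] by metis
  have c: "has_grad_hess (\<lambda>y. - ?P x) (\<lambda>y. 0) (\<lambda>y h. 0) (ball (0::real^'n) (norm x))"
    by (auto simp: has_grad_hess_def)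
  have "\<bar>?P 0 + - ?P x\<bar> \<le> 0"
  proof (rule harmonic_abs_le[OF has_grad_hess_add[OF has_grad_hess_subset[OF gh] c]])
    have "continuous_on (cball 0 (norm x)) ?P"
      by (rule continuous_on_subset[OF has_grad_hess_continuous_on(1)[OF gh]]) (use x in auto)
    then show "continuous_on (cball 0 (norm x)) (\<lambda>y. ?P y + - ?P x)"
      by (intro continuous_intros)
    show "\<bar>?P y + - ?P x\<bar> \<le> 0" if "norm y = norm x" for y
      using sphere_potential_radial[of y x] that x
      by (simp add: poisson_integral_eq_potential dot_square_norm)
  qed (use x tr in \<open>auto simp: lin_trace_simps\<close>)
  moreover have "?P 0 = 1"
  proof -
    have "?P 0 = (\<integral>(\<zeta>::real^'n). 1 \<partial>sphere_measure)"
      unfolding poisson_integral_def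
      by (rule sphere_integral_cong) (simp add: poisson_kernel_def dot_square_norm)
    then show ?thesis by simp
  qed
  ultimately show ?thesis by simp
qed

text \<open>The factor \<open>1 - \<bar>y\<bar>\<^sup>2\<close> makes the kernel small near the sphere, uniformly away from the pole.\<close>

lemma poisson_kernel_away_from_pole:
  fixes y \<zeta> :: "real^'n"
  assumes y: "norm y < 1" and d: "d > 0" "d \<le> dist y \<zeta>"
  shows "poisson_kernel y \<zeta> \<le> (1 - y \<bullet> y) * d\<^sup>2 powr (- (real CARD('n) / 2))"
proof -
  have "d\<^sup>2 \<le> (y - \<zeta>) \<bullet> (y - \<zeta>)"
    using d by (simp add: dot_square_norm dist_norm power_mono)
  then have "((y - \<zeta>) \<bullet> (y - \<zeta>)) powr (- (real CARD('n) / 2)) \<le> d\<^sup>2 powr (- (real CARD('n) / 2))"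
    using d by (intro powr_mono2') auto
  then show ?thesis
    using y unfolding poisson_kernel_def by (intro mult_left_mono) (auto simp: norm_less_1_iff)
qed

text \<open>The difference of the two sides is harmonic, so it suffices to make it small on a sphere of radius
  \<open>\<rho>\<close> close to 1. There the kernel is a probability density that is concentrated near \<open>y\<close>, where the
  values of \<open>u\<close> differ little from \<open>u y\<close>.\<close>

theorem poisson_representation:
  fixes u :: "real^'n \<Rightarrow> real"
  assumes gh: "has_grad_hess u g H (ball 0 1)" and harm: "\<And>x. norm x < 1 \<Longrightarrow> lin_trace (H x) = 0"
    and cont: "continuous_on (cball 0 1) u" and x: "norm x < 1"
  shows "u x = poisson_integral u x"
proof -
  let ?P = "poisson_integral u"
  let ?n = "real CARD('n)"
  have cs: "continuous_on (sphere 0 1) u"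
    by (rule continuous_on_subset[OF cont]) auto
  obtain g' H' where gh': "has_grad_hess ?P g' H' (ball 0 1)"
    and harm': "\<And>x. norm x < 1 \<Longrightarrow> lin_trace (H' x) = 0"
    using poisson_integral_harmonic[OF cs] by metis
  have "bounded (u ` cball 0 1)"
    by (intro compact_imp_bounded compact_continuous_image cont) simp
  then obtain M where M: "M > 0" "\<And>y. norm y \<le> 1 \<Longrightarrow> \<bar>u y\<bar> \<le> M"
    by (auto simp: bounded_pos)
  have "\<bar>u x + (-1) * ?P x\<bar> \<le> e" if e: "e > 0" for e
  proof -
    have "uniformly_continuous_on (cball 0 1) u"
      by (intro compact_uniformly_continuous cont) simp
    then obtain d where d: "d > 0"
      "\<And>y z. norm y \<le> 1 \<Longrightarrow> norm z \<le> 1 \<Longrightarrow> dist y z < d \<Longrightarrow> \<bar>u z - u y\<bar> < e / 2"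
      unfolding uniformly_continuous_on_def dist_real_def using e
      by (metis (no_types, opaque_lifting) dist_commute half_gt_zero mem_cball_0)
    \<comment> \<open>Where \<open>dist y \<zeta> \<ge> d\<close>, the integrand below is at most \<open>(1 - \<rho>\<^sup>2) K\<close>.\<close>
    define K where "K = d\<^sup>2 powr (- (?n / 2)) * (2 * M)"
    have K: "K > 0" using d M by (simp add: K_def)
    \<comment> \<open>As \<open>1 - \<rho>\<^sup>2 \<le> 2 (1 - \<rho>)\<close>, this choice makes \<open>(1 - \<rho>\<^sup>2) K\<close> at most \<open>e / 2\<close>; the \<open>1 / 2\<close> keeps \<open>\<rho>\<close> positive.\<close>
    define \<rho> where "\<rho> = max (norm x) (1 - min (e / (4 * K)) (1 / 2))"
    have \<rho>: "norm x \<le> \<rho>" "\<rho> < 1" "0 \<le> \<rho>" "1 - \<rho> \<le> e / (4 * K)"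
      using x e K norm_ge_zero[of x] by (auto simp: \<rho>_def less_max_iff_disj le_max_iff_disj)
    have K\<rho>: "(1 - \<rho>\<^sup>2) * K \<le> e / 2"
    proof -
      have "1 - \<rho>\<^sup>2 = (1 - \<rho>) * (1 + \<rho>)" by (simp add: algebra_simps power2_eq_square)
      also have "\<dots> \<le> e / (4 * K) * 2"
        using \<rho> e K by (intro mult_mono) auto
      finally show ?thesis using K by (simp add: field_simps)
    qed
    have bdry: "\<bar>u y + (-1) * ?P y\<bar> \<le> e" if y: "norm y = \<rho>" for y
    proof -
      have y1: "norm y < 1" using y \<rho> by simp
      have yy: "y \<bullet> y = \<rho>\<^sup>2" using y by (simp add: dot_square_norm)
      have pw: "\<bar>poisson_kernel y \<zeta> * (u y - u \<zeta>)\<bar> \<le> poisson_kernel y \<zeta> * (e / 2) + e / 2"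
        if z: "norm \<zeta> = 1" for \<zeta>
      proof (cases "dist y \<zeta> < d")
        case True
        then have "\<bar>u y - u \<zeta>\<bar> \<le> e / 2"
          using d(2)[of \<zeta> y] y1 z by (simp add: dist_commute)
        then show ?thesis
          using poisson_kernel_pos[OF y1 z] e
          by (simp add: abs_mult mult_left_mono add_increasing2)
      next
        case False
        have "\<bar>u y - u \<zeta>\<bar> \<le> 2 * M"
          using M(2)[of y] M(2)[of \<zeta>] y1 z by simp
        then have "\<bar>poisson_kernel y \<zeta> * (u y - u \<zeta>)\<bar> \<le> ((1 - \<rho>\<^sup>2) * d\<^sup>2 powr (- (?n / 2))) * (2 * M)"
          unfolding abs_mult
          using poisson_kernel_away_from_pole[OF y1 d(1), of \<zeta>] False poisson_kernel_pos[OF y1 z]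
          by (intro mult_mono) (auto simp: yy)
        also have "\<dots> \<le> e / 2" using K\<rho> by (simp add: K_def mult.assoc)
        finally show ?thesis
          using poisson_kernel_pos[OF y1 z] e by (simp add: add_increasing)
      qed
      have "u y = (\<integral>\<zeta>. poisson_kernel y \<zeta> * u y \<partial>sphere_measure)"
        using poisson_integral_one[OF y1] by (simp add: poisson_integral_def)
      moreover have "integrable sphere_measure (\<lambda>\<zeta>. poisson_kernel y \<zeta> * u y)"
        "integrable sphere_measure (\<lambda>\<zeta>. poisson_kernel y \<zeta> * u \<zeta>)"
        by (intro integrable_sphere_continuous continuous_intros y1 cs)+
      ultimately have "u y + (-1) * ?P y = (\<integral>\<zeta>. poisson_kernel y \<zeta> * (u y - u \<zeta>) \<partial>sphere_measure)"
        unfolding poisson_integral_def by (simp add: right_diff_distrib Bochner_Integration.integral_diff)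
      also have "\<bar>\<dots>\<bar> \<le> (\<integral>\<zeta>. \<bar>poisson_kernel y \<zeta> * (u y - u \<zeta>)\<bar> \<partial>sphere_measure)"
        by (rule integral_abs_bound)
      also have "\<dots> \<le> (\<integral>\<zeta>. poisson_kernel y \<zeta> * (e / 2) + e / 2 \<partial>sphere_measure)"
        by (rule sphere_integral_mono) (use pw in \<open>auto intro!: continuous_intros y1 cs\<close>)
      also have "\<dots> = poisson_integral (\<lambda>_. 1) y * (e / 2) + e / 2"
        unfolding poisson_integral_def
        by (subst Bochner_Integration.integral_add)
           (auto intro!: integrable_sphere_continuous continuous_intros y1)
      also have "\<dots> = e" using poisson_integral_one[OF y1] by simp
      finally show ?thesis .
    qed
    have sub: "ball 0 \<rho> \<subseteq> ball (0::real^'n) 1" "cball 0 \<rho> \<subseteq> ball (0::real^'n) 1" using \<rho> by auto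
    show ?thesis
    proof (rule harmonic_abs_le[OF has_grad_hess_subset[OF has_grad_hess_add[OF gh has_grad_hess_cmult[OF gh']] sub(1)] _ _ bdry \<rho>(1)])
      have "continuous_on (cball 0 \<rho>) u" "continuous_on (cball 0 \<rho>) ?P"
        by (rule continuous_on_subset[OF has_grad_hess_continuous_on(1) sub(2)], rule gh gh')+
      then show "continuous_on (cball 0 \<rho>) (\<lambda>x. u x + (-1) * ?P x)"
        by (intro continuous_intros)
      show "lin_trace (\<lambda>h. H y h + (-1) *\<^sub>R H' y h) = 0" if "norm y < \<rho>" for y
        using harm[of y] harm'[of y] that \<rho>(2) by (simp only: lin_trace_simps)
    qed
  qed
  then have "\<bar>u x + (-1) * ?P x\<bar> \<le> 0"
    by (rule field_le_epsilon) simp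
  then show ?thesis by simp
qed

lemma poisson_integral_harmonic_on:
  assumes "continuous_on (sphere 0 1) f"
  shows "poisson_integral f harmonic_on ball 0 1"
  using poisson_integral_harmonic[OF assms] unfolding harmonic_on_iff_grad_hess
  by (metis mem_ball_0)


section \<open>The hypergeometric equation\<close>

definition hypergeometric_coeff :: "real \<Rightarrow> real \<Rightarrow> real \<Rightarrow> nat \<Rightarrow> real" where
  "hypergeometric_coeff a b c k = pochhammer a k * pochhammer b k / (pochhammer c k * fact k)"

lemma hypergeometric_F_eq: "hypergeometric_F a b c z = (\<Sum>k. hypergeometric_coeff a b c k * z ^ k)"
  by (simp add: hypergeometric_F_def hypergeometric_coeff_def)

lemma hypergeometric_coeff_Suc:
  assumes "c > 0"
  shows "(c + real k) * real (Suc k) * hypergeometric_coeff a b c (Suc k)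
    = (a + real k) * (b + real k) * hypergeometric_coeff a b c k"
proof -
  have "c + real k > 0" "pochhammer c k > 0"
    using assms by (auto simp: pochhammer_pos add_pos_nonneg)
  then show ?thesis
    unfolding hypergeometric_coeff_def pochhammer_Suc fact_Suc of_nat_Suc
    by (simp add: divide_simps)
qed

text \<open>The ratio test in the form of an inequality, since all coefficients from some index on vanish when
  \<open>a\<close> or \<open>b\<close> is a nonpositive integer.\<close>

lemma summable_hypergeometric:
  fixes z :: real
  assumes c: "c > 0" and z: "\<bar>z\<bar> < 1"
  shows "summable (\<lambda>k. hypergeometric_coeff a b c k * z ^ k)"
proof -
  obtain r where r: "\<bar>z\<bar> < r" "r < 1" using dense[OF z] by blast
  have quot: "(\<lambda>k. (d + real k) / (e + real k)) \<longlonglongrightarrow> 1" if e: "e > 0" for d e :: real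
  proof -
    have "filterlim (\<lambda>k. e + real k) at_infinity sequentially"
      by (intro filterlim_at_top_imp_at_infinity filterlim_tendsto_add_at_top[OF tendsto_const]
          filterlim_real_sequentially)
    then have "(\<lambda>k. 1 + (d - e) / (e + real k)) \<longlonglongrightarrow> 1 + 0"
      by (intro tendsto_add tendsto_const tendsto_divide_0[OF tendsto_const])
    moreover have "1 + (d - e) / (e + real k) = (d + real k) / (e + real k)" for k
      using e add_pos_nonneg[OF e of_nat_0_le_iff[of k]] by (simp add: field_simps)
    ultimately show ?thesis by simp
  qed
  have "(\<lambda>k. \<bar>(a + real k) / (c + real k) * ((b + real k) / (1 + real k))\<bar> * \<bar>z\<bar>) \<longlonglongrightarrow> \<bar>1 * 1\<bar> * \<bar>z\<bar>"
    by (intro tendsto_intros quot c) simp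
  then have "(\<lambda>k. \<bar>(a + real k) * (b + real k) / ((c + real k) * (1 + real k))\<bar> * \<bar>z\<bar>) \<longlonglongrightarrow> \<bar>z\<bar>"
    by simp
  then have "\<forall>\<^sub>F k in sequentially. \<bar>(a + real k) * (b + real k) / ((c + real k) * (1 + real k))\<bar> * \<bar>z\<bar> < r"
    using r by (intro order_tendstoD) auto
  then obtain N where N: "\<And>k. k \<ge> N \<Longrightarrow> \<bar>(a + real k) * (b + real k) / ((c + real k) * (1 + real k))\<bar> * \<bar>z\<bar> < r"
    by (auto simp: eventually_sequentially)
  show ?thesis
  proof (rule summable_ratio_test[OF r(2)])
    fix k assume k: "N \<le> k"
    have pos: "(c + real k) * (1 + real k) > 0" using c by simp
    then have "hypergeometric_coeff a b c (Suc k)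
        = (a + real k) * (b + real k) / ((c + real k) * (1 + real k)) * hypergeometric_coeff a b c k"
      using hypergeometric_coeff_Suc[OF c, of k a b] by (simp add: field_simps)
    then have "norm (hypergeometric_coeff a b c (Suc k) * z ^ Suc k)
      = (\<bar>(a + real k) * (b + real k) / ((c + real k) * (1 + real k))\<bar> * \<bar>z\<bar>) * norm (hypergeometric_coeff a b c k * z ^ k)"
      by (simp add: abs_mult power_abs)
    also have "\<dots> \<le> r * norm (hypergeometric_coeff a b c k * z ^ k)"
      using N[OF k] by (intro mult_right_mono) auto
    finally show "norm (hypergeometric_coeff a b c (Suc k) * z ^ Suc k) \<le> r * norm (hypergeometric_coeff a b c k * z ^ k)" .
  qed
qed

lemma sums_power_shift:
  fixes z :: real
  assumes "(\<lambda>k. b (Suc k) * z ^ k) sums s" "b 0 = 0"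
  shows "(\<lambda>k. b k * z ^ k) sums (z * s)"
proof -
  have "(\<lambda>k. b (Suc k) * z ^ Suc k) sums (z * s)"
    using sums_mult[OF assms(1), of z] by (simp add: mult_ac)
  then show ?thesis using assms(2) by (subst (asm) sums_Suc_iff) simp
qed

text \<open>Gauss's equation is the recurrence of the coefficients, read off term by term.\<close>

lemma hypergeometric_equation:
  assumes c: "c > 0"
  obtains h1 h2 where
    "\<And>z. \<bar>z\<bar> < 1 \<Longrightarrow> (hypergeometric_F a b c has_real_derivative h1 z) (at z)"
    "\<And>z. \<bar>z\<bar> < 1 \<Longrightarrow> (h1 has_real_derivative h2 z) (at z)"
    "\<And>z. \<bar>z\<bar> < 1 \<Longrightarrow> z * (1 - z) * h2 z + (c - (a + b + 1) * z) * h1 z - a * b * hypergeometric_F a b c z = 0"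
proof -
  let ?a = "hypergeometric_coeff a b c"
  define h1 where "h1 z = (\<Sum>k. diffs ?a k * z ^ k)" for z
  define h2 where "h2 z = (\<Sum>k. diffs (diffs ?a) k * z ^ k)" for z
  have sum0: "summable (\<lambda>k. ?a k * z ^ k)" if "norm z < 1" for z
    using summable_hypergeometric[OF c] that by simp
  have sum1: "summable (\<lambda>k. diffs ?a k * z ^ k)" if "norm z < 1" for z
    by (rule termdiff_converges[OF that sum0])
  have sum2: "summable (\<lambda>k. diffs (diffs ?a) k * z ^ k)" if "norm z < 1" for z
    by (rule termdiff_converges[OF that sum1])
  have "(hypergeometric_F a b c has_real_derivative h1 z) (at z)" if z: "\<bar>z\<bar> < 1" for z
  proof -
    obtain K where K: "\<bar>z\<bar> < K" "K < 1" using dense[OF z] by blast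
    then show ?thesis
      using termdiffs_strong[OF sum0[of K], of z] by (simp add: h1_def hypergeometric_F_eq[abs_def])
  qed
  moreover have "(h1 has_real_derivative h2 z) (at z)" if z: "\<bar>z\<bar> < 1" for z
  proof -
    obtain K where K: "\<bar>z\<bar> < K" "K < 1" using dense[OF z] by blast
    then show ?thesis
      using termdiffs_strong[OF sum1[of K], of z] by (simp add: h1_def[abs_def] h2_def)
  qed
  moreover have "z * (1 - z) * h2 z + (c - (a + b + 1) * z) * h1 z - a * b * hypergeometric_F a b c z = 0"
    if z: "\<bar>z\<bar> < 1" for z
  proof -
    have z': "norm z < 1" using z by simp
    have s0: "(\<lambda>k. ?a k * z ^ k) sums hypergeometric_F a b c z"
      unfolding hypergeometric_F_eq by (rule summable_sums[OF sum0[OF z']])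
    have s1: "(\<lambda>k. (real (Suc k) * ?a (Suc k)) * z ^ k) sums h1 z"
      using summable_sums[OF sum1[OF z']] by (simp add: h1_def diffs_def)
    have s2: "(\<lambda>k. (real (Suc k) * (real (Suc (Suc k)) * ?a (Suc (Suc k)))) * z ^ k) sums h2 z"
      using summable_sums[OF sum2[OF z']] by (simp add: h2_def diffs_def)
    \<comment> \<open>With \<open>s0\<close> and \<open>s1\<close>, these are the terms of the equation, as series in the same powers \<open>z ^ k\<close>.\<close>
    have t1: "(\<lambda>k. (real k * ?a k) * z ^ k) sums (z * h1 z)"
      by (rule sums_power_shift[OF s1]) simp
    have t2: "(\<lambda>k. (real k * (real (Suc k) * ?a (Suc k))) * z ^ k) sums (z * h2 z)"
      by (rule sums_power_shift[OF s2]) simp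
    have "(\<lambda>k. ((real (Suc k) - 1) * (real (Suc k) * ?a (Suc k))) * z ^ k) sums (z * h2 z)"
      using t2 by simp
    then have u2: "(\<lambda>k. ((real k - 1) * (real k * ?a k)) * z ^ k) sums (z * (z * h2 z))"
      by (rule sums_power_shift) simp
    have "(\<lambda>k. (real k * (real (Suc k) * ?a (Suc k))) * z ^ k - ((real k - 1) * (real k * ?a k)) * z ^ k
        + c * ((real (Suc k) * ?a (Suc k)) * z ^ k) - (a + b + 1) * ((real k * ?a k) * z ^ k) - a * b * (?a k * z ^ k))
      sums (z * h2 z - z * (z * h2 z) + c * h1 z - (a + b + 1) * (z * h1 z) - a * b * hypergeometric_F a b c z)"
      by (intro sums_diff sums_add sums_mult t2 u2 s1 t1 s0)
    moreover have "(real k * (real (Suc k) * ?a (Suc k))) * z ^ k - ((real k - 1) * (real k * ?a k)) * z ^ k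
        + c * ((real (Suc k) * ?a (Suc k)) * z ^ k) - (a + b + 1) * ((real k * ?a k) * z ^ k) - a * b * (?a k * z ^ k) = 0" for k
    proof -
      have "(real k * (real (Suc k) * ?a (Suc k))) * z ^ k - ((real k - 1) * (real k * ?a k)) * z ^ k
        + c * ((real (Suc k) * ?a (Suc k)) * z ^ k) - (a + b + 1) * ((real k * ?a k) * z ^ k) - a * b * (?a k * z ^ k)
        = ((c + real k) * real (Suc k) * ?a (Suc k) - (a + real k) * (b + real k) * ?a k) * z ^ k"
        by algebra
      then show ?thesis using hypergeometric_coeff_Suc[OF c, of k a b] by simp
    qed
    ultimately have "(\<lambda>k. 0) sums (z * h2 z - z * (z * h2 z) + c * h1 z - (a + b + 1) * (z * h1 z) - a * b * hypergeometric_F a b c z)"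
      by simp
    then have "z * h2 z - z * (z * h2 z) + c * h1 z - (a + b + 1) * (z * h1 z) - a * b * hypergeometric_F a b c z = 0"
      using sums_unique2 sums_zero by blast
    then show ?thesis by (simp add: algebra_simps)
  qed
  ultimately show ?thesis using that by blast
qed

lemma hypergeometric_F_0: "hypergeometric_F a b c 0 = 1"
  unfolding hypergeometric_F_eq using powser_zero[of "hypergeometric_coeff a b c"]
  by (simp add: hypergeometric_coeff_def)

text \<open>Euler's transformation on the level of the differential equation: multiplication by
  \<open>(1 - t)\<^bsup>c-\<alpha>-\<beta>\<^esup>\<close> takes the solution with parameters \<open>c - \<beta>, c - \<alpha>\<close> to a solution of the equation with
  parameters \<open>\<alpha>, \<beta>\<close>.\<close>

lemma euler_transformed_equation:
  fixes \<alpha> \<beta> c :: real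
  assumes c: "c > 0"
    and f_def: "f = (\<lambda>t. (1 - t) powr (c - \<alpha> - \<beta>) * hypergeometric_F (c - \<beta>) (c - \<alpha>) c t)"
  obtains f1 f2 where
    "\<And>t. \<bar>t\<bar> < 1 \<Longrightarrow> (f has_real_derivative f1 t) (at t)"
    "\<And>t. \<bar>t\<bar> < 1 \<Longrightarrow> (f1 has_real_derivative f2 t) (at t)"
    "\<And>t. \<bar>t\<bar> < 1 \<Longrightarrow> t * (1 - t) * f2 t + (c - (\<alpha> + \<beta> + 1) * t) * f1 t - \<alpha> * \<beta> * f t = 0"
proof -
  define m where "m = c - \<alpha> - \<beta>"
  let ?h = "hypergeometric_F (c - \<beta>) (c - \<alpha>) c"
  obtain h1 h2 where h1: "\<And>z. \<bar>z\<bar> < 1 \<Longrightarrow> (?h has_real_derivative h1 z) (at z)"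
    and h2: "\<And>z. \<bar>z\<bar> < 1 \<Longrightarrow> (h1 has_real_derivative h2 z) (at z)"
    and ode: "\<And>z. \<bar>z\<bar> < 1 \<Longrightarrow> z * (1 - z) * h2 z + (c - ((c - \<beta>) + (c - \<alpha>) + 1) * z) * h1 z - (c - \<beta>) * (c - \<alpha>) * ?h z = 0"
    by (rule hypergeometric_equation[OF c, of "c - \<beta>" "c - \<alpha>"]) (rule that; blast)
  define f1 where "f1 t = (1 - t) powr (m - 1) * ((1 - t) * h1 t - m * ?h t)" for t
  define f2 where "f2 t = (1 - t) powr (m - 2) * ((1 - t)\<^sup>2 * h2 t - 2 * m * (1 - t) * h1 t + m * (m - 1) * ?h t)" for t
  have pw: "((\<lambda>t. (1 - t) powr a) has_real_derivative - a * (1 - t) powr (a - 1)) (at t)" if "\<bar>t\<bar> < 1" for t a :: real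
    using that by (auto intro!: derivative_eq_intros)
  have pw_Suc: "(1 - t) powr (a + 1) = (1 - t) powr a * (1 - t)" if "\<bar>t\<bar> < 1" for t a :: real
    using that by (simp add: powr_add)
  have f: "f = (\<lambda>t. (1 - t) powr m * ?h t)" by (simp add: f_def m_def)
  have "(f has_real_derivative f1 t) (at t)" if t: "\<bar>t\<bar> < 1" for t
  proof -
    have e: "(1 - t) powr m = (1 - t) powr (m - 1) * (1 - t)"
      using pw_Suc[OF t, of "m - 1"] by simp
    show ?thesis
      unfolding f by (rule DERIV_cong[OF DERIV_mult[OF pw[OF t, of m] h1[OF t]]]) (unfold f1_def e, algebra)
  qed
  moreover have "(f1 has_real_derivative f2 t) (at t)" if t: "\<bar>t\<bar> < 1" for t
  proof -
    have e: "(1 - t) powr (m - 1) = (1 - t) powr (m - 2) * (1 - t)" "m - 1 - 1 = m - 2"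
      using pw_Suc[OF t, of "m - 2"] by simp_all
    have "((\<lambda>t. 1 - t) has_real_derivative -1) (at t)"
      by (auto intro!: derivative_eq_intros)
    note D = DERIV_diff[OF DERIV_mult[OF this h2[OF t]] DERIV_cmult[OF h1[OF t], of m]]
    show ?thesis
      unfolding f1_def[abs_def]
      by (rule DERIV_cong[OF DERIV_mult[OF pw[OF t, of "m - 1"] D]]) (unfold f2_def e, algebra)
  qed
  moreover have "t * (1 - t) * f2 t + (c - (\<alpha> + \<beta> + 1) * t) * f1 t - \<alpha> * \<beta> * f t = 0" if t: "\<bar>t\<bar> < 1" for t
  proof -
    define P where "P = (1 - t) powr (m - 2)"
    have P1: "(1 - t) powr (m - 1) = P * (1 - t)" using pw_Suc[OF t, of "m - 2"] by (simp add: P_def)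
    have P2: "(1 - t) powr m = P * (1 - t) * (1 - t)" using pw_Suc[OF t, of "m - 1"] P1 by simp
    have "t * (1 - t) * f2 t + (c - (\<alpha> + \<beta> + 1) * t) * f1 t - \<alpha> * \<beta> * f t
      = P * (1 - t)\<^sup>2 * (t * (1 - t) * h2 t + (c - ((c - \<beta>) + (c - \<alpha>) + 1) * t) * h1 t - (c - \<beta>) * (c - \<alpha>) * ?h t)"
      unfolding f f1_def f2_def P1 P2 P_def[symmetric] using m_def by algebra
    then show ?thesis using ode[OF t] by simp
  qed
  ultimately show ?thesis using that by blast
qed


section \<open>The mean of a power of the Poisson kernel\<close>

text \<open>For radial functions, in the variable \<open>t = \<bar>x\<bar>\<^sup>2\<close>, the equation of the potential is the hypergeometric
  equation with parameters \<open>s\<close>, \<open>\<beta> = s + 1 - n/2\<close> and \<open>n/2\<close>. Both sides solve it, and since \<open>4 \<beta> s > 0\<close> the maximum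
  principle applies to \<open>f - c S\<close>, where \<open>S\<close> denotes the potential and \<open>c\<close> is chosen such that the
  difference vanishes at \<open>x\<close>, hence on the sphere through \<open>x\<close>. The values at the origin then give
  \<open>c = 1\<close>.\<close>

theorem sphere_potential_hypergeometric:
  fixes x :: "real^'n"
  defines "n \<equiv> real CARD('n)"
  assumes x: "norm x < 1" and s: "s > 0" "s + 1 - n / 2 > 0"
  shows "sphere_potential s (\<lambda>_. 1 :: real) x
    = (1 - x \<bullet> x) powr (n - 1 - 2 * s) * hypergeometric_F (n - 1 - s) (n / 2 - s) (n / 2) (x \<bullet> x)"
proof -
  define \<beta> where "\<beta> = s + 1 - n / 2"
  let ?S = "sphere_potential s (\<lambda>_::real^'n. 1::real)"
  define f where "f t = (1 - t) powr (n / 2 - s - \<beta>) * hypergeometric_F (n / 2 - \<beta>) (n / 2 - s) (n / 2) t" for t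
  then have f: "f = (\<lambda>t. (1 - t) powr (n / 2 - s - \<beta>) * hypergeometric_F (n / 2 - \<beta>) (n / 2 - s) (n / 2) t)"
    by blast
  have n: "n / 2 > 0" by (simp add: n_def)
  have \<beta>: "\<beta> > 0" using s by (simp add: \<beta>_def)
  obtain f1 f2 where f1: "\<And>t. \<bar>t\<bar> < 1 \<Longrightarrow> (f has_real_derivative f1 t) (at t)"
    and f2: "\<And>t. \<bar>t\<bar> < 1 \<Longrightarrow> (f1 has_real_derivative f2 t) (at t)"
    and ode: "\<And>t. \<bar>t\<bar> < 1 \<Longrightarrow> t * (1 - t) * f2 t + (n / 2 - (s + \<beta> + 1) * t) * f1 t - s * \<beta> * f t = 0"
    by (rule euler_transformed_equation[OF n f]) (rule that; blast)
  let ?G = "\<lambda>y::real^'n. (2 * f1 (y \<bullet> y)) *\<^sub>R y"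
  let ?K = "\<lambda>(y::real^'n) h. (4 * f2 (y \<bullet> y) * (y \<bullet> h)) *\<^sub>R y + (2 * f1 (y \<bullet> y)) *\<^sub>R h"
  have abs1: "\<bar>y \<bullet> y\<bar> < 1" if "norm y < 1" for y :: "real^'n"
    using that by (simp add: norm_less_1_iff)
  have gf: "has_grad_hess (\<lambda>y. f (y \<bullet> y)) ?G ?K (ball 0 1)"
    by (rule has_grad_hess_radial) (auto intro!: f1 f2 abs1)
  have eqf: "(1 - y \<bullet> y) * lin_trace (?K y) = 4 * \<beta> * (y \<bullet> ?G y + s * f (y \<bullet> y))" if y: "norm y < 1" for y
  proof -
    have T: "lin_trace (?K y) = 4 * f2 (y \<bullet> y) * (y \<bullet> y) + 2 * f1 (y \<bullet> y) * n"
      unfolding lin_trace_simps lin_trace_id scaleR_scaleR[symmetric] lin_trace_rank_one by (simp add: n_def)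
    have G: "y \<bullet> ?G y = 2 * f1 (y \<bullet> y) * (y \<bullet> y)" by simp
    have n\<beta>: "n / 2 = s + 1 - \<beta>" by (simp add: \<beta>_def)
    then have n: "n = 2 * (s + 1 - \<beta>)" by simp
    show ?thesis
      using ode[OF abs1[OF y]] unfolding T G n\<beta> unfolding n by algebra
  qed
  have one: "continuous_on (sphere 0 1) (\<lambda>_::real^'n. 1::real)" by simp
  obtain G H where gS: "has_grad_hess ?S G H (ball 0 1)"
    and eqS: "\<And>y. norm y < 1 \<Longrightarrow> (1 - y \<bullet> y) * lin_trace (H y) = 4 * \<beta> * (y \<bullet> G y + s * ?S y)"
    by (rule sphere_potential_equation[OF one, of s, folded n_def, folded \<beta>_def]) (rule that; blast)
  define c where "c = f (x \<bullet> x) / ?S x"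
  \<comment> \<open>Used for \<open>\<sigma> = 1\<close> and \<open>\<sigma> = -1\<close>.\<close>
  have le: "\<sigma> * (f (0 \<bullet> (0::real^'n)) + (- c) * ?S 0) \<le> 0" for \<sigma> :: real
  proof -
    let ?w = "\<lambda>y. \<sigma> * (f (y \<bullet> y) + (- c) * ?S y)"
    let ?g = "\<lambda>y. \<sigma> *\<^sub>R (?G y + (- c) *\<^sub>R G y)"
    let ?L = "\<lambda>y h. \<sigma> *\<^sub>R (?K y h + (- c) *\<^sub>R H y h)"
    have gw: "has_grad_hess ?w ?g ?L (ball 0 1)"
      by (intro has_grad_hess_cmult has_grad_hess_add gf gS)
    have "?w 0 \<le> 0"
    proof (rule maximum_principle[where u = ?w and g = ?g and H = ?L and x = 0 and r = "norm x"])
      show "has_grad_hess ?w ?g ?L (ball 0 (norm x))"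
        by (rule has_grad_hess_subset[OF gw]) (use x in auto)
      show "continuous_on (cball 0 (norm x)) ?w"
        by (rule continuous_on_subset[OF has_grad_hess_continuous_on(1)[OF gw]]) (use x in auto)
      show "?w y \<le> 0" if "norm y = norm x" for y
        using that sphere_potential_radial[of y x s] x sphere_potential_one_pos[OF x, of s] s
        by (simp add: c_def dot_square_norm)
      show "lin_trace (?L y) > 0" if y: "norm y < norm x" "?w y > 0" "?g y = 0" for y
      proof -
        have y1: "norm y < 1" using y x by simp
        have "(1 - y \<bullet> y) * lin_trace (?L y) = \<sigma> * ((1 - y \<bullet> y) * lin_trace (?K y) - c * ((1 - y \<bullet> y) * lin_trace (H y)))"
          by (simp only: lin_trace_simps(1,3)[of _ "H y"] lin_trace_simps(1)[of "?K y"] lin_trace_simps(3)[of \<sigma>] lin_trace_simps(3)[of "-c"]) algebra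
        also have "\<dots> = 4 * \<beta> * (y \<bullet> ?g y + s * ?w y)"
          unfolding eqf[OF y1] eqS[OF y1] by (simp add: inner_add_right algebra_simps)
        also have "\<dots> = 4 * \<beta> * s * ?w y" unfolding y(3) by simp
        finally have "(1 - y \<bullet> y) * lin_trace (?L y) > 0" using \<beta> s y(2) by simp
        then show ?thesis using y1 by (simp add: norm_less_1_iff zero_less_mult_iff)
      qed
    qed simp
    then show ?thesis .
  qed
  have "f (0 \<bullet> (0::real^'n)) + (- c) * ?S 0 = 0"
    using le[of 1] le[of "-1"] by simp
  then have "c = 1"
    by (simp add: sphere_potential_one_at_0 f_def hypergeometric_F_0)
  then have "?S x = f (x \<bullet> x)"
    using sphere_potential_one_pos[OF x, of s] s by (simp add: c_def field_simps)
  then show ?thesis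
    by (simp add: f_def \<beta>_def algebra_simps)
qed

lemma integral_poisson_kernel_powr_eq_potential:
  fixes x :: "real^'n"
  assumes x: "norm x < 1"
  shows "(\<integral>\<zeta>. poisson_kernel x \<zeta> powr q \<partial>sphere_measure)
    = (1 - x \<bullet> x) powr q * sphere_potential (real CARD('n) * q / 2) (\<lambda>_. 1) x"
proof -
  have "(\<integral>\<zeta>. poisson_kernel x \<zeta> powr q \<partial>sphere_measure)
      = (\<integral>\<zeta>. (1 - x \<bullet> x) powr q * (((x - \<zeta>) \<bullet> (x - \<zeta>)) powr (- (real CARD('n) * q / 2)) *\<^sub>R 1) \<partial>sphere_measure)"
    using x by (intro sphere_integral_cong) (simp add: poisson_kernel_def powr_mult powr_powr norm_less_1_iff)
  then show ?thesis
    by (simp only: sphere_potential_def integral_mult_right_zero)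
qed

text \<open>For \<open>s = n q/2\<close> and \<open>q \<ge> 1\<close> both \<open>s\<close> and \<open>s + 1 - n/2\<close> are positive.\<close>

theorem integral_poisson_kernel_powr:
  fixes x :: "real^'n"
  defines "n \<equiv> real CARD('n)"
  assumes x: "norm x < 1" and q: "q \<ge> 1"
  shows "(\<integral>\<zeta>. poisson_kernel x \<zeta> powr q \<partial>sphere_measure)
    = (1 - (norm x)\<^sup>2) powr ((n - 1) * (1 - q))
      * hypergeometric_F (-1 + n - n * q / 2) (1 / 2 * (n - n * q)) (n / 2) ((norm x)\<^sup>2)"
proof -
  have n: "n > 0" by (simp add: n_def)
  have nq: "n * q \<ge> n" using n q by simp
  have "(\<integral>\<zeta>. poisson_kernel x \<zeta> powr q \<partial>sphere_measure)
      = (1 - x \<bullet> x) powr q * sphere_potential (n * q / 2) (\<lambda>_. 1) x"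
    unfolding n_def by (rule integral_poisson_kernel_powr_eq_potential[OF x])
  also have "\<dots> = (1 - x \<bullet> x) powr q * ((1 - x \<bullet> x) powr (n - 1 - 2 * (n * q / 2))
      * hypergeometric_F (n - 1 - n * q / 2) (n / 2 - n * q / 2) (n / 2) (x \<bullet> x))"
    using sphere_potential_hypergeometric[OF x, of "n * q / 2", folded n_def] nq n by simp
  also have "\<dots> = (1 - x \<bullet> x) powr (q + (n - 1 - n * q))
      * hypergeometric_F (n - 1 - n * q / 2) (n / 2 - n * q / 2) (n / 2) (x \<bullet> x)"
    by (simp add: powr_add)
  also have "q + (n - 1 - n * q) = (n - 1) * (1 - q)" by (simp add: algebra_simps)
  also have "n - 1 - n * q / 2 = -1 + n - n * q / 2" by simp
  also have "n / 2 - n * q / 2 = 1 / 2 * (n - n * q)" by (simp add: field_simps)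
  finally show ?thesis by (simp add: dot_square_norm)
qed

text \<open>So the quotient in the pointwise estimate is the \<open>L\<^sup>q\<close> norm of the Poisson kernel: the exponent
  \<open>(n - 1) (1 - 1/q)\<close> equals \<open>(n - 1) / p\<close> for the exponent \<open>p\<close> conjugate to \<open>q\<close>.\<close>

lemma hardy_const_eq:
  fixes x :: "real^'n"
  assumes x: "norm x < 1" and q: "q \<ge> 1"
  shows "hardy_const q x = (1 - (norm x)\<^sup>2) powr ((real CARD('n) - 1) * (1 - 1 / q))
      * (\<integral>\<zeta>. poisson_kernel x \<zeta> powr q \<partial>sphere_measure) powr (1 / q)"
proof -
  define n where "n = real CARD('n)"
  define D where "D = 1 - (norm x)\<^sup>2"
  define F where "F = hypergeometric_F (-1 + n - n * q / 2) (1 / 2 * (n - n * q)) (n / 2) ((norm x)\<^sup>2)"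
  define Q where "Q = (\<integral>\<zeta>. poisson_kernel x \<zeta> powr q \<partial>sphere_measure)"
  have D: "D > 0" using x by (simp add: D_def norm_less_1_iff dot_square_norm)
  have Q: "Q = D powr ((n - 1) * (1 - q)) * F"
    unfolding Q_def D_def F_def n_def by (rule integral_poisson_kernel_powr[OF x q])
  have Q0: "Q \<ge> 0" by (simp add: Q_def)
  have "F = D powr ((n - 1) * (q - 1)) * Q"
    unfolding Q using D by (simp add: powr_add[symmetric] mult.assoc[symmetric] distrib_left[symmetric])
  then have "F powr (1 / q) = D powr ((n - 1) * (q - 1) * (1 / q)) * Q powr (1 / q)"
    using D Q0 by (simp add: powr_mult powr_powr)
  also have "(n - 1) * (q - 1) * (1 / q) = (n - 1) * (1 - 1 / q)"
    using q by (simp add: field_simps)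
  finally show ?thesis
    by (simp add: hardy_const_def Let_def F_def D_def Q_def n_def)
qed

lemma integral_poisson_kernel_powr_pos:
  fixes x :: "real^'n"
  assumes x: "norm x < 1" and q: "q \<ge> 0"
  shows "0 < (\<integral>\<zeta>. poisson_kernel x \<zeta> powr q \<partial>sphere_measure)"
  using sphere_potential_one_pos[OF x, of "real CARD('n) * q / 2"] x q
  by (simp add: integral_poisson_kernel_powr_eq_potential[OF x] norm_less_1_iff)


section \<open>Hoelder's inequality\<close>

text \<open>Young's inequality applied to the normalized functions.\<close>

lemma Holder_inequality:
  fixes f g :: "'a \<Rightarrow> real"
  assumes pq: "p > 1" "q > 1" "1 / p + 1 / q = 1"
    and nn: "\<And>x. x \<in> space M \<Longrightarrow> 0 \<le> f x" "\<And>x. x \<in> space M \<Longrightarrow> 0 \<le> g x"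
    and int: "integrable M (\<lambda>x. f x powr p)" "integrable M (\<lambda>x. g x powr q)" "integrable M (\<lambda>x. f x * g x)"
  shows "(\<integral>x. f x * g x \<partial>M) \<le> (\<integral>x. f x powr p \<partial>M) powr (1 / p) * (\<integral>x. g x powr q \<partial>M) powr (1 / q)"
proof -
  define A where "A = (\<integral>x. f x powr p \<partial>M)"
  define B where "B = (\<integral>x. g x powr q \<partial>M)"
  have AB: "A \<ge> 0" "B \<ge> 0" by (simp_all add: A_def B_def)
  \<comment> \<open>Normalizing by \<open>A + e\<close> and \<open>B + e\<close> instead of \<open>A\<close> and \<open>B\<close> avoids division by zero.\<close>
  have *: "(\<integral>x. f x * g x \<partial>M) \<le> (A + e) powr (1 / p) * (B + e) powr (1 / q)" if e: "e > 0" for e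
  proof -
    define a where "a = (A + e) powr (1 / p)"
    define b where "b = (B + e) powr (1 / q)"
    have pos: "A + e > 0" "B + e > 0" using AB e by auto
    then have ab: "a > 0" "b > 0" "a powr p = A + e" "b powr q = B + e"
      using pq by (simp_all add: a_def b_def powr_powr)
    have "(\<integral>x. f x * g x \<partial>M) \<le> (\<integral>x. a * b * (f x powr p * (1 / ((A + e) * p)) + g x powr q * (1 / ((B + e) * q))) \<partial>M)"
    proof (rule integral_mono)
      fix x assume x: "x \<in> space M"
      have "(f x / a) * (g x / b) \<le> (f x / a) powr p / p + (g x / b) powr q / q"
        using pq nn[OF x] ab by (intro Youngs_inequality) auto
      also have "\<dots> = f x powr p * (1 / ((A + e) * p)) + g x powr q * (1 / ((B + e) * q))"
        using nn[OF x] ab by (simp add: powr_divide)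
      finally show "f x * g x \<le> a * b * (f x powr p * (1 / ((A + e) * p)) + g x powr q * (1 / ((B + e) * q)))"
        using ab by (simp add: field_simps)
    qed (intro int Bochner_Integration.integrable_add integrable_mult_right integrable_mult_left)+
    also have "\<dots> = a * b * (A * (1 / ((A + e) * p)) + B * (1 / ((B + e) * q)))"
      unfolding A_def B_def
      by (simp only: integral_mult_right_zero integral_mult_left_zero Bochner_Integration.integral_add
          integrable_mult_left int)
    also have "\<dots> \<le> a * b * (1 / p + 1 / q)"
    proof -
      have "C * (1 / ((C + e) * s)) \<le> 1 / s" if "C \<ge> 0" "s > 1" for C s
      proof -
        have "C / (C + e) * (1 / s) \<le> 1 * (1 / s)"
          using that e by (intro mult_right_mono) auto
        then show ?thesis by simp
      qed
      then have "A * (1 / ((A + e) * p)) \<le> 1 / p" "B * (1 / ((B + e) * q)) \<le> 1 / q"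
        using AB pq by blast+
      then show ?thesis using ab by (intro mult_left_mono add_mono) auto
    qed
    finally show ?thesis using pq by (simp add: a_def b_def)
  qed
  have "((\<lambda>e. (A + e) powr (1 / p) * (B + e) powr (1 / q)) \<longlongrightarrow> (A + 0) powr (1 / p) * (B + 0) powr (1 / q)) (at_right 0)"
    using pq AB by (intro tendsto_mult tendsto_powr' tendsto_add tendsto_const tendsto_ident_at)
      (auto simp: eventually_at_filter)
  moreover have "\<forall>\<^sub>F e in at_right 0. (\<integral>x. f x * g x \<partial>M) \<le> (A + e) powr (1 / p) * (B + e) powr (1 / q)"
    using * by (auto simp: eventually_at_filter)
  ultimately have "(\<integral>x. f x * g x \<partial>M) \<le> (A + 0) powr (1 / p) * (B + 0) powr (1 / q)"
    by (rule tendsto_lowerbound) simp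
  then show ?thesis by (simp add: A_def B_def)
qed

lemma continuous_on_abs_powr:
  fixes f :: "'a::topological_space \<Rightarrow> real"
  assumes "continuous_on S f" "p > 0"
  shows "continuous_on S (\<lambda>x. \<bar>f x\<bar> powr p)"
  using assms by (intro continuous_on_powr' continuous_intros) auto

lemma Holder_inequality_sphere:
  fixes f g :: "real^'n \<Rightarrow> real"
  assumes pq: "p > 1" "q > 1" "1 / p + 1 / q = 1"
    and nn: "\<And>\<zeta>. norm \<zeta> = 1 \<Longrightarrow> 0 \<le> f \<zeta>" "\<And>\<zeta>. norm \<zeta> = 1 \<Longrightarrow> 0 \<le> g \<zeta>"
    and cont: "continuous_on (sphere 0 1) f" "continuous_on (sphere 0 1) g"
  shows "(\<integral>\<zeta>. f \<zeta> * g \<zeta> \<partial>sphere_measure)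
    \<le> (\<integral>\<zeta>. f \<zeta> powr p \<partial>sphere_measure) powr (1 / p) * (\<integral>\<zeta>. g \<zeta> powr q \<partial>sphere_measure) powr (1 / q)"
proof (rule Holder_inequality[OF pq])
  show "integrable sphere_measure (\<lambda>\<zeta>. f \<zeta> powr p)" "integrable sphere_measure (\<lambda>\<zeta>. g \<zeta> powr q)"
    using pq nn by (auto intro!: integrable_sphere_continuous continuous_on_powr' cont continuous_on_const)
qed (auto intro!: nn integrable_sphere_continuous continuous_on_mult cont)


section \<open>Pointwise bounds in harmonic Hardy spaces\<close>

lemma abs_poisson_integral_le:
  assumes "norm x < 1" "continuous_on (sphere 0 1) f"
  shows "\<bar>poisson_integral f x\<bar> \<le> (\<integral>\<zeta>. poisson_kernel x \<zeta> * \<bar>f \<zeta>\<bar> \<partial>sphere_measure)"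
proof -
  have "\<bar>poisson_integral f x\<bar> \<le> (\<integral>\<zeta>. \<bar>poisson_kernel x \<zeta> * f \<zeta>\<bar> \<partial>sphere_measure)"
    unfolding poisson_integral_def by (rule integral_abs_bound)
  also have "\<dots> = (\<integral>\<zeta>. poisson_kernel x \<zeta> * \<bar>f \<zeta>\<bar> \<partial>sphere_measure)"
    using poisson_kernel_pos[OF assms(1)] by (intro sphere_integral_cong) (simp add: abs_mult abs_of_pos)
  finally show ?thesis .
qed

text \<open>The dilated functions \<open>u(r \<cdot>)\<close> with \<open>r < 1\<close> are continuous up to the sphere and hence represented by
  their boundary values; Hoelder's inequality bounds them uniformly in \<open>r\<close>.\<close>

theorem hardy_space_pointwise_bound:
  fixes u :: "real^'n \<Rightarrow> real"
  assumes pq: "p > 1" "q > 1" "1 / p + 1 / q = 1"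
    and u: "u harmonic_on ball 0 1" and fin: "hardy_mean p u < \<infinity>" and x: "norm x < 1"
  shows "\<bar>u x\<bar> \<le> (\<integral>\<zeta>. poisson_kernel x \<zeta> powr q \<partial>sphere_measure) powr (1 / q) * enn2real (hardy_mean p u) powr (1 / p)"
    (is "_ \<le> ?R")
proof -
  obtain g H where gh: "has_grad_hess u g H (ball 0 1)" and tr: "\<And>x. norm x < 1 \<Longrightarrow> lin_trace (H x) = 0"
    using u by (auto simp: harmonic_on_iff_grad_hess)
  have cu: "continuous_on (ball 0 1) u" by (rule has_grad_hess_continuous_on(1)[OF gh])
  have *: "\<bar>u (r *\<^sub>R x)\<bar> \<le> ?R" if r: "0 < r" "r < 1" for r
  proof -
    let ?u = "\<lambda>y. u (r *\<^sub>R y)"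
    have r1: "norm (r *\<^sub>R y) < 1" if "norm y \<le> 1" for y :: "real^'n"
    proof -
      have "norm (r *\<^sub>R y) = r * norm y" using r by simp
      also have "\<dots> \<le> r * 1" using r that by (intro mult_left_mono) auto
      also have "\<dots> < 1" using r by simp
      finally show ?thesis .
    qed
    have cont: "continuous_on (cball 0 1) ?u"
      by (rule continuous_on_compose2[OF cu]) (auto intro!: continuous_intros r1 simp del: norm_scaleR)
    have cs: "continuous_on (sphere 0 1) ?u"
      by (rule continuous_on_subset[OF cont]) auto
    have gh': "has_grad_hess u g H ((\<lambda>y. r *\<^sub>R y) ` ball 0 1)"
      by (rule has_grad_hess_subset[OF gh]) (auto intro!: r1 simp del: norm_scaleR)
    have tr': "lin_trace (\<lambda>h. (r * r) *\<^sub>R H (r *\<^sub>R y) h) = 0" if "norm y < 1" for y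
      unfolding lin_trace_simps using tr[OF r1, of y] that by simp
    have "?u x = poisson_integral ?u x"
      by (rule poisson_representation[OF has_grad_hess_dilation[OF gh'] tr' cont x])
    then have "\<bar>?u x\<bar> \<le> (\<integral>\<zeta>. \<bar>?u \<zeta>\<bar> * poisson_kernel x \<zeta> \<partial>sphere_measure)"
      using abs_poisson_integral_le[OF x cs] by (simp add: mult.commute)
    also have "\<dots> \<le> (\<integral>\<zeta>. \<bar>?u \<zeta>\<bar> powr p \<partial>sphere_measure) powr (1 / p)
        * (\<integral>\<zeta>. poisson_kernel x \<zeta> powr q \<partial>sphere_measure) powr (1 / q)"
      using poisson_kernel_pos[OF x]
      by (intro Holder_inequality_sphere pq continuous_intros cs x) (auto intro: less_imp_le)
    also have "\<dots> \<le> enn2real (hardy_mean p u) powr (1 / p)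
        * (\<integral>\<zeta>. poisson_kernel x \<zeta> powr q \<partial>sphere_measure) powr (1 / q)"
    proof (intro mult_right_mono powr_mono2)
      have "integrable sphere_measure (\<lambda>\<zeta>. \<bar>?u \<zeta>\<bar> powr p)"
        using pq by (intro integrable_sphere_continuous continuous_on_abs_powr cs) simp
      then have "ennreal (\<integral>\<zeta>. \<bar>?u \<zeta>\<bar> powr p \<partial>sphere_measure) = (\<integral>\<^sup>+\<zeta>. ennreal (\<bar>?u \<zeta>\<bar> powr p) \<partial>sphere_measure)"
        by (subst nn_integral_eq_integral) auto
      also have "\<dots> \<le> hardy_mean p u"
        unfolding hardy_mean_def by (rule SUP_upper) (use r in auto)
      finally have "enn2real (ennreal (\<integral>\<zeta>. \<bar>?u \<zeta>\<bar> powr p \<partial>sphere_measure)) \<le> enn2real (hardy_mean p u)"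
        using fin by (intro enn2real_mono) auto
      then show "(\<integral>\<zeta>. \<bar>?u \<zeta>\<bar> powr p \<partial>sphere_measure) \<le> enn2real (hardy_mean p u)"
        by simp
    qed (use pq in auto)
    finally show ?thesis by (simp add: mult.commute)
  qed
  have "isCont u (1 *\<^sub>R x)"
    using cu x by (simp add: continuous_on_eq_continuous_at)
  then have "((\<lambda>r. u (r *\<^sub>R x)) \<longlongrightarrow> u (1 *\<^sub>R x)) (at_left 1)"
    by (rule isCont_tendsto_compose) (intro tendsto_intros)
  then have "((\<lambda>r. \<bar>u (r *\<^sub>R x)\<bar>) \<longlongrightarrow> \<bar>u x\<bar>) (at_left 1)"
    by (intro tendsto_rabs) simp
  moreover have "\<forall>\<^sub>F r in at_left 1. \<bar>u (r *\<^sub>R x)\<bar> \<le> ?R"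
    using eventually_at_left_real[of 0 1] by (rule eventually_mono) (use * in auto)
  ultimately show ?thesis
    by (rule tendsto_upperbound) simp
qed


section \<open>Extremal functions\<close>

text \<open>Jensen's inequality for the probability density \<open>P(x, \<cdot>)\<close>, obtained from Hoelder's inequality by
  splitting \<open>P = P\<^bsup>1/p\<^esup> P\<^bsup>1/q\<^esup>\<close>.\<close>

lemma poisson_integral_powr_le:
  fixes f :: "real^'n \<Rightarrow> real"
  assumes p: "p > 1" and x: "norm x < 1" and f: "continuous_on (sphere 0 1) f"
  shows "\<bar>poisson_integral f x\<bar> powr p \<le> poisson_integral (\<lambda>\<zeta>. \<bar>f \<zeta>\<bar> powr p) x"
proof -
  define q where "q = p / (p - 1)"
  have pq: "p > 1" "q > 1" "1 / p + 1 / q = 1"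
    using p by (simp_all add: q_def field_simps)
  note P = poisson_kernel_pos[OF x]
  let ?P = "poisson_kernel x"
  have c: "continuous_on (sphere 0 1) (\<lambda>\<zeta>. ?P \<zeta> powr (1 / p))" for p :: real
    by (intro continuous_intros x ballI) (use P in force)
  have "\<bar>poisson_integral f x\<bar> \<le> (\<integral>\<zeta>. ?P \<zeta> * \<bar>f \<zeta>\<bar> \<partial>sphere_measure)"
    by (rule abs_poisson_integral_le[OF x f])
  also have "\<dots> = (\<integral>\<zeta>. (?P \<zeta> powr (1 / p) * \<bar>f \<zeta>\<bar>) * ?P \<zeta> powr (1 / q) \<partial>sphere_measure)"
  proof (rule sphere_integral_cong)
    fix \<zeta> :: "real^'n" assume z: "norm \<zeta> = 1"
    have "?P \<zeta> = ?P \<zeta> powr (1 / p) * ?P \<zeta> powr (1 / q)"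
      using P[OF z] pq by (simp flip: powr_add)
    then show "?P \<zeta> * \<bar>f \<zeta>\<bar> = (?P \<zeta> powr (1 / p) * \<bar>f \<zeta>\<bar>) * ?P \<zeta> powr (1 / q)"
      by (simp add: mult_ac)
  qed
  also have "\<dots> \<le> (\<integral>\<zeta>. (?P \<zeta> powr (1 / p) * \<bar>f \<zeta>\<bar>) powr p \<partial>sphere_measure) powr (1 / p)
      * (\<integral>\<zeta>. (?P \<zeta> powr (1 / q)) powr q \<partial>sphere_measure) powr (1 / q)"
    by (intro Holder_inequality_sphere pq continuous_on_mult c continuous_on_rabs f) auto
  also have "(\<integral>\<zeta>. (?P \<zeta> powr (1 / q)) powr q \<partial>sphere_measure) = poisson_integral (\<lambda>_. 1) x"
    unfolding poisson_integral_def using P pq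
    by (intro sphere_integral_cong) (auto simp: powr_powr less_imp_le)
  also have "(\<integral>\<zeta>. (?P \<zeta> powr (1 / p) * \<bar>f \<zeta>\<bar>) powr p \<partial>sphere_measure) = poisson_integral (\<lambda>\<zeta>. \<bar>f \<zeta>\<bar> powr p) x"
    unfolding poisson_integral_def using P pq
    by (intro sphere_integral_cong) (auto simp: powr_mult powr_powr less_imp_le)
  finally have le: "\<bar>poisson_integral f x\<bar> \<le> poisson_integral (\<lambda>\<zeta>. \<bar>f \<zeta>\<bar> powr p) x powr (1 / p)"
    using poisson_integral_one[OF x] by simp
  have "poisson_integral (\<lambda>\<zeta>. \<bar>f \<zeta>\<bar> powr p) x \<ge> 0"
    unfolding poisson_integral_def using P
    by (intro Bochner_Integration.integral_nonneg_AE AE_I2) (auto simp: less_imp_le)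
  then show ?thesis
    using powr_mono2[OF _ _ le, of p] p by (simp add: powr_powr)
qed

text \<open>By symmetry the kernel also has total mass 1 in its first variable.\<close>

lemma nn_integral_poisson_kernel:
  fixes \<zeta> :: "real^'n"
  assumes r: "0 \<le> r" "r < 1" and z: "norm \<zeta> = 1"
  shows "(\<integral>\<^sup>+\<eta>. ennreal (poisson_kernel (r *\<^sub>R \<eta>) \<zeta>) \<partial>sphere_measure) = 1"
proof -
  have rz: "norm (r *\<^sub>R \<zeta>) < 1" using r z by simp
  have "(\<integral>\<^sup>+\<eta>. ennreal (poisson_kernel (r *\<^sub>R \<eta>) \<zeta>) \<partial>sphere_measure)
    = (\<integral>\<^sup>+\<eta>. ennreal (poisson_kernel (r *\<^sub>R \<zeta>) \<eta>) \<partial>sphere_measure)"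
    by (rule nn_integral_cong) (use z in \<open>simp add: poisson_kernel_commute\<close>)
  also have "\<dots> = ennreal (\<integral>\<eta>. poisson_kernel (r *\<^sub>R \<zeta>) \<eta> \<partial>sphere_measure)"
    by (rule nn_integral_eq_integral)
       (auto intro!: integrable_sphere_continuous continuous_on_poisson_kernel rz AE_I2 less_imp_le poisson_kernel_pos simp del: norm_scaleR)
  also have "(\<integral>\<eta>. poisson_kernel (r *\<^sub>R \<zeta>) \<eta> \<partial>sphere_measure) = 1"
    using poisson_integral_one[OF rz] by (simp add: poisson_integral_def)
  finally show ?thesis by simp
qed

text \<open>Poisson integration is a contraction from \<open>L\<^sup>p\<close> of the sphere into \<open>h\<^sup>p\<close>: Jensen's inequality reduces
  this to \<open>p = 1\<close>, where the order of integration can be exchanged.\<close>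

theorem hardy_mean_poisson_integral_le:
  fixes f :: "real^'n \<Rightarrow> real"
  assumes p: "p > 1" and f: "continuous_on (sphere 0 1) f"
  shows "hardy_mean p (poisson_integral f) \<le> ennreal (\<integral>\<zeta>. \<bar>f \<zeta>\<bar> powr p \<partial>sphere_measure)"
  unfolding hardy_mean_def
proof (rule SUP_least)
  fix r :: real assume "r \<in> {0<..<1}"
  then have r: "0 < r" "r < 1" by auto
  let ?M = "sphere_measure :: (real^'n) measure"
  let ?g = "\<lambda>\<zeta>. \<bar>f \<zeta>\<bar> powr p"
  interpret P: pair_sigma_finite ?M ?M ..
  have gc: "continuous_on (sphere 0 1) ?g"
    using p by (intro continuous_on_abs_powr f) simp
  have rn: "norm (r *\<^sub>R \<eta>) < 1" if "norm \<eta> = 1" for \<eta> :: "real^'n"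
    using that r by simp
  have id: "(\<lambda>x. x) \<in> borel_measurable ?M"
    by (rule measurable_sphere_continuous) (rule continuous_on_id)
  have [measurable]: "fst \<in> borel_measurable (?M \<Otimes>\<^sub>M ?M)" "snd \<in> borel_measurable (?M \<Otimes>\<^sub>M ?M)"
    using measurable_compose[OF measurable_fst id] measurable_compose[OF measurable_snd id] by auto
  have [measurable]: "?g \<in> borel_measurable ?M"
    by (rule measurable_sphere_continuous[OF gc])
  have meas: "(\<lambda>(\<eta>, \<zeta>). ennreal (poisson_kernel (r *\<^sub>R \<eta>) \<zeta> * ?g \<zeta>)) \<in> borel_measurable (?M \<Otimes>\<^sub>M ?M)"
    unfolding poisson_kernel_def case_prod_beta by measurable
  have "(\<integral>\<^sup>+\<eta>. ennreal (\<bar>poisson_integral f (r *\<^sub>R \<eta>)\<bar> powr p) \<partial>?M)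
    \<le> (\<integral>\<^sup>+\<eta>. \<integral>\<^sup>+\<zeta>. ennreal (poisson_kernel (r *\<^sub>R \<eta>) \<zeta> * ?g \<zeta>) \<partial>?M \<partial>?M)"
  proof (rule nn_integral_mono)
    fix \<eta> :: "real^'n" assume "\<eta> \<in> space ?M"
    then have e: "norm (r *\<^sub>R \<eta>) < 1" by (intro rn) simp
    have "ennreal (\<bar>poisson_integral f (r *\<^sub>R \<eta>)\<bar> powr p) \<le> ennreal (poisson_integral ?g (r *\<^sub>R \<eta>))"
      by (intro ennreal_leI poisson_integral_powr_le p e f)
    also have "\<dots> = (\<integral>\<^sup>+\<zeta>. ennreal (poisson_kernel (r *\<^sub>R \<eta>) \<zeta> * ?g \<zeta>) \<partial>?M)"
      unfolding poisson_integral_def using poisson_kernel_pos[OF e]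
      by (intro nn_integral_eq_integral[symmetric] integrable_sphere_continuous continuous_on_mult
          continuous_on_poisson_kernel e gc AE_I2) (auto simp: less_imp_le)
    finally show "ennreal (\<bar>poisson_integral f (r *\<^sub>R \<eta>)\<bar> powr p)
      \<le> (\<integral>\<^sup>+\<zeta>. ennreal (poisson_kernel (r *\<^sub>R \<eta>) \<zeta> * ?g \<zeta>) \<partial>?M)" .
  qed
  also have "\<dots> = (\<integral>\<^sup>+\<zeta>. \<integral>\<^sup>+\<eta>. ennreal (poisson_kernel (r *\<^sub>R \<eta>) \<zeta> * ?g \<zeta>) \<partial>?M \<partial>?M)"
    by (rule P.Fubini'[OF meas, symmetric])
  also have "\<dots> = (\<integral>\<^sup>+\<zeta>. ennreal (?g \<zeta>) \<partial>?M)"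
  proof (rule nn_integral_cong)
    fix \<zeta> :: "real^'n" assume "\<zeta> \<in> space ?M"
    then have z: "norm \<zeta> = 1" by simp
    have [measurable]: "(\<lambda>x. x) \<in> borel_measurable ?M" by (rule id)
    have m: "(\<lambda>\<eta>. ennreal (poisson_kernel (r *\<^sub>R \<eta>) \<zeta>)) \<in> borel_measurable ?M"
      unfolding poisson_kernel_def by measurable
    have "(\<integral>\<^sup>+\<eta>. ennreal (poisson_kernel (r *\<^sub>R \<eta>) \<zeta> * ?g \<zeta>) \<partial>?M)
      = (\<integral>\<^sup>+\<eta>. ennreal (poisson_kernel (r *\<^sub>R \<eta>) \<zeta>) * ennreal (?g \<zeta>) \<partial>?M)"
      by (rule nn_integral_cong) (simp add: ennreal_mult'')
    also have "\<dots> = ennreal (?g \<zeta>)"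
      using nn_integral_poisson_kernel[of r \<zeta>] r z by (simp add: nn_integral_multc[OF m])
    finally show "(\<integral>\<^sup>+\<eta>. ennreal (poisson_kernel (r *\<^sub>R \<eta>) \<zeta> * ?g \<zeta>) \<partial>?M) = ennreal (?g \<zeta>)" .
  qed
  also have "\<dots> = ennreal (\<integral>\<zeta>. ?g \<zeta> \<partial>?M)"
    by (intro nn_integral_eq_integral integrable_sphere_continuous gc AE_I2) auto
  finally show "(\<integral>\<^sup>+\<eta>. ennreal (\<bar>poisson_integral f (r *\<^sub>R \<eta>)\<bar> powr p) \<partial>?M) \<le> ennreal (\<integral>\<zeta>. ?g \<zeta> \<partial>?M)" .
qed

text \<open>For the boundary values \<open>f = P(x, \<cdot>)\<^bsup>q-1\<^esup>\<close> one has \<open>f\<^sup>p = P(x, \<cdot>)\<^sup>q\<close>, so equality holds in Hoelder's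
  inequality \<open>\<integral> P f d\<sigma> \<le> \<parallel>P\<parallel>\<^sub>q \<parallel>f\<parallel>\<^sub>p\<close>. The \<open>h\<^sup>p\<close> norm of the Poisson integral is at most \<open>\<parallel>f\<parallel>\<^sub>p = Q\<^bsup>1/p\<^esup>\<close>, while
  its value at \<open>x\<close> is \<open>Q = Q\<^bsup>1/q\<^esup> Q\<^bsup>1/p\<^esup>\<close>.\<close>

theorem hardy_space_extremal:
  fixes x :: "real^'n"
  assumes pq: "p > 1" "q > 1" "1 / p + 1 / q = 1" and x: "norm x < 1"
  defines "Q \<equiv> \<integral>\<zeta>. poisson_kernel x \<zeta> powr q \<partial>sphere_measure"
  obtains u where "u harmonic_on ball 0 1" "hardy_mean p u \<le> ennreal Q" "u x = Q"
proof
  let ?f = "\<lambda>\<zeta>. poisson_kernel x \<zeta> powr (q - 1)"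
  note P = poisson_kernel_pos[OF x]
  have f: "continuous_on (sphere 0 1) ?f"
    by (intro continuous_intros x ballI) (use P in force)
  show "poisson_integral ?f harmonic_on ball 0 1"
    by (rule poisson_integral_harmonic_on[OF f])
  have "(q - 1) * p = q" using pq by (simp add: field_simps)
  then have "(\<integral>\<zeta>. \<bar>?f \<zeta>\<bar> powr p \<partial>sphere_measure) = Q"
    unfolding Q_def by (intro sphere_integral_cong) (simp add: powr_powr)
  then show "hardy_mean p (poisson_integral ?f) \<le> ennreal Q"
    using hardy_mean_poisson_integral_le[OF pq(1) f] by simp
  show "poisson_integral ?f x = Q"
    unfolding Q_def poisson_integral_def
    by (rule sphere_integral_cong) (use P in \<open>simp add: powr_mult_base less_imp_le\<close>)
qed


section \<open>The sharp pointwise estimate\<close>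

lemma hardy_norm_one: "hardy_norm \<infinity> (\<lambda>_::real^'n. 1) = 1"
  by (simp add: hardy_norm_def)

lemma one_in_hardy_space: "(\<lambda>_::real^'n. 1) \<in> hardy_space \<infinity>"
proof -
  have "(\<lambda>_::real^'n. 1) harmonic_on ball 0 1"
    unfolding harmonic_on_iff_grad_hess
    by (rule exI[of _ "\<lambda>_. 0"], rule exI[of _ "\<lambda>_ _. 0"]) (simp add: has_grad_hess_def lin_trace_def)
  then show ?thesis by (simp add: hardy_space_def image_constant_conv)
qed

lemma hardy_const_one:
  fixes x :: "real^'n"
  assumes "norm x < 1"
  shows "hardy_const 1 x = 1"
proof -
  have "(\<integral>\<zeta>. poisson_kernel x \<zeta> powr 1 \<partial>sphere_measure) = poisson_integral (\<lambda>_. 1) x"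
    unfolding poisson_integral_def
    using poisson_kernel_pos[OF assms] by (intro sphere_integral_cong) (simp add: less_imp_le)
  then have "(\<integral>\<zeta>. poisson_kernel x \<zeta> powr 1 \<partial>sphere_measure) = 1"
    using poisson_integral_one[OF assms] by simp
  then show ?thesis
    using assms by (subst hardy_const_eq[OF assms order_refl])
      (simp add: norm_less_1_iff dot_square_norm)
qed

theorem theorem1p1:
  fixes p :: ereal and q :: real
  assumes "CARD('n) \<ge> 2"
    and "1 < p"
    and "1 / p + 1 / ereal q = 1"
  shows "(\<forall>u \<in> hardy_space p. \<forall>x \<in> ball (0 :: real^'n) 1.
            \<bar>u x\<bar> \<le> hardy_const q x
                     / (1 - (norm x)\<^sup>2) powr real_of_ereal (ereal (real CARD('n) - 1) / p)
                     * hardy_norm p u)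
       \<and> (\<forall>x \<in> ball (0 :: real^'n) 1. \<forall>C < hardy_const q x.
            \<not> (\<forall>u \<in> hardy_space p.
                  \<bar>u x\<bar> \<le> C / (1 - (norm x)\<^sup>2) powr real_of_ereal (ereal (real CARD('n) - 1) / p)
                           * hardy_norm p u))"
proof -
  let ?n = "real CARD('n)"
  have pos: "1 - (norm x)\<^sup>2 > 0" if "norm x < 1" for x :: "real^'n"
    using that by (simp add: norm_less_1_iff dot_square_norm)
  have q0: "q \<noteq> 0"
  proof
    assume "q = 0"
    then have "1 / ereal q = \<infinity>" by (simp add: divide_ereal_def zero_ereal_def[symmetric])
    from assms(3)[unfolded this] show False by simp
  qed
  have q_inv: "1 / ereal q = ereal (1 / q)"
    using q0 by (simp add: one_ereal_def)
  show ?thesis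
  proof (cases "p = \<infinity>")
    case True
    then have "ereal (1 / q) = 1" using assms(3) by (simp add: q_inv)
    then have q1: "q = 1" using q0 by (simp add: one_ereal_def)
    have exponent: "(1 - (norm x)\<^sup>2) powr real_of_ereal (ereal (?n - 1) / p) = 1" if "norm x < 1" for x :: "real^'n"
      using pos[OF that] by (simp add: True)
    have "\<bar>u x\<bar> \<le> hardy_norm p u" if "u \<in> hardy_space p" "norm x < 1" for u and x :: "real^'n"
    proof -
      have "bounded (u ` ball 0 1)" using that(1) True by (simp add: hardy_space_def)
      then obtain B where "\<forall>y\<in>u ` ball 0 1. norm y \<le> B" unfolding bounded_iff by blast
      then have "bdd_above ((\<lambda>y. \<bar>u y\<bar>) ` ball 0 1)" by (intro bdd_aboveI2[of _ _ B]) auto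
      then show ?thesis using that(2) True by (auto simp: hardy_norm_def intro: cSUP_upper)
    qed
    moreover have "\<exists>u\<in>hardy_space p. \<not> \<bar>u x\<bar> \<le> C * hardy_norm p u" if "C < 1" for x :: "real^'n" and C
    proof
      show "(\<lambda>_::real^'n. 1) \<in> hardy_space p" unfolding True by (rule one_in_hardy_space)
      show "\<not> \<bar>1\<bar> \<le> C * hardy_norm p (\<lambda>_::real^'n. 1)"
        unfolding True hardy_norm_one using that by simp
    qed
    ultimately show ?thesis
      by (auto simp: exponent q1 hardy_const_one)
  next
    case False
    then obtain r where p: "p = ereal r" using assms(2) by (cases p) auto
    have r: "r > 1" using assms(2) p by (simp add: one_ereal_def)
    have rq: "1 / r + 1 / q = 1"
      using assms(3) r unfolding q_inv by (simp add: p one_ereal_def)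
    have q: "q > 1"
    proof -
      have "0 < 1 / r" "1 / r < 1" using r by simp_all
      then have "0 < 1 / q" "1 / q < 1" using rq by linarith+
      then show ?thesis by (simp add: field_simps split: if_splits)
    qed
    have exponent: "real_of_ereal (ereal (?n - 1) / p) = (?n - 1) / r"
      using r by (simp add: p)
    define Q where "Q x = (\<integral>\<zeta>. poisson_kernel x \<zeta> powr q \<partial>sphere_measure)" for x :: "real^'n"
    have const: "hardy_const q x = (1 - (norm x)\<^sup>2) powr ((?n - 1) / r) * Q x powr (1 / q)"
      if "norm x < 1" for x :: "real^'n"
    proof -
      have "1 - 1 / q = 1 / r" using rq by simp
      then have "(?n - 1) * (1 - 1 / q) = (?n - 1) / r" by simp
      then show ?thesis
        using hardy_const_eq[OF that, of q] q by (simp add: Q_def)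
    qed
    have space: "u \<in> hardy_space p \<longleftrightarrow> u harmonic_on ball 0 1 \<and> hardy_mean r u < \<infinity>"
      and norm: "hardy_norm p u = enn2real (hardy_mean r u) powr (1 / r)" for u :: "real^'n \<Rightarrow> real"
      by (simp_all add: hardy_space_def hardy_norm_def p)
    have upper: "\<bar>u x\<bar> \<le> hardy_const q x / (1 - (norm x)\<^sup>2) powr ((?n - 1) / r) * hardy_norm p u"
      if "u \<in> hardy_space p" "norm x < 1" for u and x :: "real^'n"
      using hardy_space_pointwise_bound[OF r q rq, of u x] that pos[OF that(2)]
      by (simp add: const space norm Q_def)
    have sharp: "\<exists>u\<in>hardy_space p. \<not> \<bar>u x\<bar> \<le> C / (1 - (norm x)\<^sup>2) powr ((?n - 1) / r) * hardy_norm p u"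
      if x: "norm x < 1" and C: "C < hardy_const q x" for x :: "real^'n" and C
    proof -
      define A where "A = C / (1 - (norm x)\<^sup>2) powr ((?n - 1) / r)"
      have A: "A < Q x powr (1 / q)"
        using C pos[OF x] by (simp add: A_def const[OF x] field_simps)
      have Qpos: "Q x > 0"
        unfolding Q_def using x q by (intro integral_poisson_kernel_powr_pos) auto
      obtain u where u: "u harmonic_on ball 0 1" "hardy_mean r u \<le> ennreal (Q x)" "u x = Q x"
        using hardy_space_extremal[OF r q rq x] unfolding Q_def by metis
      have "hardy_mean r u < \<infinity>" using u(2) by (simp add: le_less_trans)
      then have mem: "u \<in> hardy_space p" using u(1) by (simp add: space)
      have "enn2real (hardy_mean r u) \<le> Q x"
        using enn2real_mono[OF u(2)] Qpos by simp
      then have N: "hardy_norm p u \<le> Q x powr (1 / r)" "hardy_norm p u \<ge> 0"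
        using r by (simp_all add: norm powr_mono2)
      have "A * hardy_norm p u < Q x"
      proof (cases "A \<le> 0")
        case True
        then have "A * hardy_norm p u \<le> 0" using N(2) by (simp add: mult_nonpos_nonneg)
        then show ?thesis using Qpos by simp
      next
        case False
        then have "A * hardy_norm p u \<le> A * Q x powr (1 / r)" using N(1) by simp
        also have "\<dots> < Q x powr (1 / q) * Q x powr (1 / r)" using A Qpos by simp
        also have "\<dots> = Q x" using Qpos rq by (simp add: powr_add[symmetric] add.commute)
        finally show ?thesis .
      qed
      then show ?thesis using mem u(3) Qpos by (intro bexI[of _ u]) (auto simp: A_def)
    qed
    show ?thesis
      unfolding exponent using upper sharp by fastforce
  qed
qed

end
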